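(* Let $n\geq 2$ be an integer. Then the discriminant of $\Psi_n(x,y)$, regarded as a polynomial in $x$ with coefficients in $\mathbb{Z}[y]$, is $$\begin{cases} \dfrac{(-1)^{\lfloor\varphi(n)/2\rfloor}(2n)^{\varphi(n)}\,y^{\varphi(n)(\varphi(n)-1)}}{p^{p^{\alpha-1}+1}}&\text{if } n=p^\alpha \text{ for some prime } p \text{ and some positive integer } \alpha;\\[2ex] \dfrac{(-1)^{\varphi(n)/2}(2n)^{\varphi(n)}\,y^{\varphi(n)(\varphi(n)-1)}}{\prod_{p\mid n}p^{\varphi(n)/(p-1)}}&\text{otherwise}, \end{cases}$$ where the product runs over the primes $p$ dividing $n$.
   Context: The Fibonacci polynomials are defined by $F_1(x)=1$, $F_2(x)=x$, and $F_n(x)=xF_{n-1}(x)+F_{n-2}(x)$ for $n\geq 3$. For $n\geq 2$, the $n$-th fibotomic polynomial $\Psi_n(x)\in\mathbb{Z}[x]$ is the product of the monic irreducible factors of $F_n(x)$ which are not factors of $F_k(x)$ for any $k<n$; also $\Psi_1(x)=1$. Thus $F_n(x)=\prod_{d\mid n}\Psi_d(x)$ for all $n\geq1$, and for $n\geq 2$, $\Psi_n(x)$ is monic of degree $\varphi(n)$, where $\varphi$ is Euler's totient function. The homogenized fibotomic polynomials are $\Psi_1(x,y)=1$ and $\Psi_n(x,y)=y^{\varphi(n)}\Psi_n(x/y)$ for $n\geq2$; these are homogeneous of degree $\varphi(n)$ and monic in $x$. The discriminant of a monic polynomial with roots $r_1,\dots,r_d$ is $\prod_{i<j}(r_i-r_j)^2$.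 *)

theory Defs
  imports "HOL-Algebra.Algebraic_Closure_Type" "HOL-Number_Theory.Number_Theory"
begin

text \<open>Fibonacci polynomials in Z[x]; F 0 = 0 is an auxiliary value making the
  recursion F(n+2) = x F(n+1) + F(n) valid from n = 1 on (F 1 = 1, F 2 = x).\<close>
fun fibpoly :: "nat \<Rightarrow> int poly" where
  "fibpoly 0 = 0"
| "fibpoly (Suc 0) = 1"
| "fibpoly (Suc (Suc n)) = [:0, 1:] * fibpoly (Suc n) + fibpoly n"

definition fibotomic :: "nat \<Rightarrow> int poly" where
  "fibotomic n = (if n \<le> 1 then 1 else
     (\<Prod>q\<in>{q. lead_coeff q = 1 \<and> irreducible q \<and> q dvd fibpoly n \<and>
               (\<forall>k. 1 \<le> k \<and> k < n \<longrightarrow> \<not> q dvd fibpoly k)}. q))"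

text \<open>Homogenized fibotomic polynomial y^phi(n) Psi_n(x/y), as a polynomial in x
  with coefficients in Z[y] (type int poly poly: outer variable x, inner y).\<close>
definition fibotomic_hom :: "nat \<Rightarrow> int poly poly" where
  "fibotomic_hom n = (if n \<le> 1 then 1 else
     (\<Sum>i\<le>totient n. monom (monom (coeff (fibotomic n) i) (totient n - i)) i))"

text \<open>Discriminant of a monic polynomial over a field k: the product of
  (r_i - r_j)^2 over i < j, where r_1..r_d are its roots (with multiplicity)
  in the algebraic closure of k.\<close>
definition roots_list_ac :: "'k::field poly \<Rightarrow> 'k alg_closure list" where
  "roots_list_ac f = (SOME xs. map_poly to_ac f = (\<Prod>r\<leftarrow>xs. [:-r, 1:]))"

definition discriminant :: "'k::field poly \<Rightarrow> 'k alg_closure" where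
  "discriminant f = (let xs = roots_list_ac f in
     (\<Prod>(i, j)\<in>{(i, j). i < j \<and> j < length xs}. (xs ! i - xs ! j) ^ 2))"

definition emb :: "int poly \<Rightarrow> int poly fract alg_closure" where
  "emb c = to_ac (Fraction_Field.Fract c 1)"

end

theory Submission
  imports Defs
begin

text \<open>
  Let $\eta$ be a primitive $2n$-th root of unity in an algebraically closed field of characteristic $0$.
  The roots of $\Psi_n$ are $r_k = i(\eta^k + \eta^{-k})$ for $0 < k < n$ coprime to $n$, and
  $r_k - r_l = i\eta^{-k}(\eta^k - \eta^l)(\eta^k - \eta^{-l})$. As $\eta^{-l} = -\eta^{n-l}$, the product
  over $l \neq k$ turns into one of the differences of the squares $z_k = \eta^{2k}$, which are the primitive
  $n$-th roots of unity, up to the factor $2/(1 - z_k^{-1})$. Hence the discriminant of $\Psi_n$ is, up to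
  sign, $2^{\varphi(n)}$ times that of the cyclotomic polynomial $\Phi_n$, divided by $\Phi_n(1)$. Both
  $\Phi_n(1)$ and the discriminant of $\Phi_n$ follow by induction on the number of prime factors of $n$ from
  $\Phi_{mp}(x) = \Phi_m(x^p)$ if $p \mid m$ and $\Phi_{mp}(x)\,\Phi_m(x) = \Phi_m(x^p)$ otherwise.
\<close>

text \<open>The two cases of the formula differ only in Phi_n(1), which is p for a power of a prime
  p and 1 for every other n >= 2; this is the extra 1 in the exponent of p in the first case. The
  field is kept arbitrary because the discriminant lives in an algebraic closure of the fraction
  field of Z[y], where homogenization multiplies each root by y. The obstacle peculiar to Psi_n is
  that it is defined by irreducible factors over Z, while the computation needs roots. The bridge is
  that an irreducible q sharing a root with an integer polynomial f divides f, together with the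
  squarefreeness of F_n. As for signs, n = 2 is the only n >= 2 with odd phi(n) and is treated
  apart; for n > 2 the contributions of i and eta cancel, and (-1)^(phi(n)/2) comes only from
  passing between ordered and unordered pairs of roots.\<close>

section \<open>Monic polynomials as products of linear factors\<close>

lemma degree_prod_linear:
  fixes A :: "'a::idom set"
  shows "degree (\<Prod>z\<in>A. [:-z, 1:]) = card A"
proof (cases "finite A")
  case True then show ?thesis by (subst degree_prod_eq_sum_degree) auto
qed auto

lemma lead_coeff_prod_linear: "lead_coeff (\<Prod>z\<in>A. [:-z, 1::'a::idom:]) = 1"
  by (simp add: lead_coeff_prod)

lemma monic_eq_prod_linear:
  fixes f :: "'a::idom poly"
  assumes "lead_coeff f = 1" "finite A" "\<And>z. z \<in> A \<Longrightarrow> poly f z = 0" "degree f = card A"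
  shows "f = (\<Prod>z\<in>A. [:-z, 1:])"
proof (rule poly_eqI_degree_lead_coeff[where n = "card A" and A = A])
  show "coeff f (card A) = coeff (\<Prod>z\<in>A. [:-z, 1:]) (card A)"
    using assms lead_coeff_prod_linear[of A] by (simp add: degree_prod_linear)
  show "poly f z = poly (\<Prod>z\<in>A. [:-z, 1:]) z" if "z \<in> A" for z
    using that assms by (auto simp: poly_prod)
qed (use assms in \<open>auto simp: degree_prod_linear\<close>)

text \<open>For a squarefree polynomial only the set of roots remains to be found; Psi_n is
  identified in this way, without knowing its degree beforehand.\<close>

lemma rsquarefree_eq_prod_roots:
  fixes f :: "'a::{alg_closed_field,field_char_0} poly"
  assumes "lead_coeff f = 1" "rsquarefree f"
  shows "f = (\<Prod>z\<in>{z. poly f z = 0}. [:-z, 1:])"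
proof -
  have "f \<noteq> 0" using assms by auto
  from alg_closed_imp_factorization[OF this] assms(1)
  obtain A where A: "f = (\<Prod>x\<in>#A. [:-x, 1:])" by auto
  have "count A x \<le> 1" for x
  proof (rule ccontr)
    assume "\<not> count A x \<le> 1"
    then have "{#x, x#} \<subseteq># A"
      by (auto simp: subseteq_mset_def)
    then obtain B where "A = {#x, x#} + B" by (auto simp: subset_mset.le_iff_add)
    with A have "f = [:-x, 1:] ^ 2 * (\<Prod>x\<in>#B. [:-x, 1:])" by (simp add: power2_eq_square mult.assoc del: mult_pCons_left mult_pCons_right)
    then have "[:-x, 1:] ^ 2 dvd f" by simp
    then have "order x f \<ge> 2" using \<open>f \<noteq> 0\<close> by (simp add: order_divides)
    with assms(2) show False unfolding rsquarefree_def by (metis numeral_le_one_iff semiring_norm(69) not_numeral_le_zero)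
  qed
  then have "A = mset_set (set_mset A)"
    by (intro multiset_eqI) (metis count_mset_set(1,3) count_greater_zero_iff finite_set_mset le_antisym less_one linorder_not_le nat_less_le not_gr0)
  moreover have "{z. poly f z = 0} = set_mset A"
    unfolding A by (auto simp: poly_prod_mset)
  ultimately show ?thesis using A by (metis (no_types, lifting) prod_unfold_prod_mset)
qed

lemma rsquarefree_dvd:
  fixes f g :: "'a::field_char_0 poly"
  assumes "f dvd g" "rsquarefree g"
  shows "rsquarefree f"
proof -
  from assms(1) obtain h where "g = f * h" by (elim dvdE)
  with assms(2) show ?thesis unfolding rsquarefree_roots by (auto simp: pderiv_mult)
qed

text \<open>Only the term that differentiates the factor at z survives. Products of root differences
  thus become values of a derivative, which the chain rule can compute.\<close>

lemma poly_pderiv_prod_linear: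
  fixes A :: "'a::idom set"
  assumes "finite A" "z \<in> A"
  shows "poly (pderiv (\<Prod>w\<in>A. [:-w, 1:])) z = (\<Prod>w\<in>A-{z}. z - w)"
proof -
  have "(\<Prod>w\<in>A. [:-w, 1:]) = [:-z, 1:] * (\<Prod>w\<in>A-{z}. [:-w, 1:])"
    using assms by (subst prod.remove[of _ z]) auto
  then show ?thesis by (simp add: pderiv_mult poly_prod pderiv_pCons del: mult_pCons_left)
qed

lemma rsquarefree_prod_linear:
  fixes A :: "'a::field_char_0 set"
  assumes "finite A"
  shows "rsquarefree (\<Prod>w\<in>A. [:-w, 1:])"
  unfolding rsquarefree_roots using assms
  by (auto simp: poly_pderiv_prod_linear poly_prod)

lemma finite_nth_roots: "p > 0 \<Longrightarrow> finite {z::'a::idom. z ^ p = w}"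
proof -
  assume "p > 0"
  have "monom 1 p - [:w:] \<noteq> 0"
    using \<open>p > 0\<close> by (metis coeff_monom coeff_pCons_0 degree_monom_eq degree_pCons_0 eq_iff_diff_eq_0 less_numeral_extra(3) zero_neq_one)
  from poly_roots_finite[OF this] show ?thesis by (simp add: poly_monom)
qed

lemma prod_nth_roots:
  fixes w :: "'a::{alg_closed_field,field_char_0}"
  assumes "p > 0" "w \<noteq> 0"
  shows "monom 1 p - [:w:] = (\<Prod>z\<in>{z. z ^ p = w}. [:-z, 1:])"
proof -
  let ?f = "monom 1 p - [:w:] :: 'a poly"
  have "?f = monom 1 p + [:-w:]" by simp
  then have deg: "degree ?f = p"
    using assms(1) by (simp only: degree_add_eq_left degree_monom_eq degree_pCons_0 one_neq_zero not_False_eq_True)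
  then have "lead_coeff ?f = 1"
    using assms(1) by (simp add: coeff_pCons split: nat.splits)
  \<comment> \<open>The derivative p X^(p-1) can vanish only at 0, and 0 is not a root since w is
    nonzero.\<close>
  moreover have "rsquarefree ?f"
    unfolding rsquarefree_roots using assms
    by (auto simp: poly_monom pderiv_diff pderiv_monom pderiv_pCons power_0_left split: if_splits)
  ultimately show ?thesis
    using rsquarefree_eq_prod_roots[of ?f] by (simp add: poly_monom)
qed

lemma card_nth_roots:
  fixes w :: "'a::{alg_closed_field,field_char_0}"
  assumes "p > 0" "w \<noteq> 0"
  shows "card {z. z ^ p = w} = p"
proof -
  have "monom 1 p - [:w:] = monom 1 p + [:-w:]" by simp
  then have "degree (monom 1 p - [:w:]) = p"
    using assms(1) by (simp only: degree_add_eq_left degree_monom_eq degree_pCons_0 one_neq_zero not_False_eq_True)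
  then show ?thesis using prod_nth_roots[OF assms] by (simp add: degree_prod_linear)
qed

section \<open>Primitive roots of unity in an algebraically closed field\<close>

text \<open>Stating the order through all exponents turns questions about orders into divisibility.
  For \<open>n = 0\<close> the set consists of 0 and the elements of infinite order, hence the
  hypotheses \<open>n > 0\<close> below.\<close>

definition prim_roots :: "nat \<Rightarrow> 'a::field set" where
  "prim_roots n = {z. \<forall>k. z ^ k = 1 \<longleftrightarrow> n dvd k}"

lemma prim_rootsD: "z \<in> prim_roots n \<Longrightarrow> z ^ k = 1 \<longleftrightarrow> n dvd k"
  by (simp add: prim_roots_def)

lemma prim_roots_nonzero: "z \<in> prim_roots n \<Longrightarrow> n > 0 \<Longrightarrow> z \<noteq> 0"
proof
  assume "z \<in> prim_roots n" "n > 0" "z = 0"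
  then show False using prim_rootsD[of z n n] by (simp add: power_0_left)
qed

lemma finite_prim_roots: "n > 0 \<Longrightarrow> finite (prim_roots n :: 'a::field set)"
proof (rule finite_subset)
  show "prim_roots n \<subseteq> {z::'a. z ^ n = 1}" by (simp add: prim_roots_def subset_iff)
qed (rule finite_nth_roots)

lemma prim_roots_1: "prim_roots (Suc 0) = {1::'a::field}"
proof -
  have "z \<in> prim_roots (Suc 0) \<Longrightarrow> z = 1" for z :: 'a using prim_rootsD[of z "Suc 0" 1] by simp
  then show ?thesis by (auto simp: prim_roots_def)
qed

lemma one_notin_prim_roots: "n > 1 \<Longrightarrow> 1 \<notin> prim_roots n"
proof
  assume "n > 1" "1 \<in> prim_roots n"
  then have "n dvd 1" using prim_rootsD[of 1 n 1] by simp
  with \<open>n > 1\<close> show False by simp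
qed

lemma power_mem_prim_roots:
  assumes "z \<in> prim_roots (m * p)" "p > 0"
  shows "z ^ p \<in> prim_roots m"
proof -
  have "(z ^ p) ^ k = 1 \<longleftrightarrow> m dvd k" for k
    using prim_rootsD[OF assms(1), of "p * k"] assms(2) by (simp add: power_mult mult.commute[of m])
  then show ?thesis by (simp add: prim_roots_def)
qed

lemma power_coprime_mem_prim_roots:
  assumes "z \<in> prim_roots n" "coprime k n"
  shows "z ^ k \<in> prim_roots n"
proof -
  have "(z ^ k) ^ j = 1 \<longleftrightarrow> n dvd j" for j
    using prim_rootsD[OF assms(1), of "k * j"] assms(2)
    by (simp add: power_mult coprime_dvd_mult_right_iff coprime_commute)
  then show ?thesis by (simp add: prim_roots_def)
qed

text \<open>If z^p has order m, then z^k = 1 gives m | k, hence p | k, say k = p j; now (z^p)^j = 1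
  gives m | j, so mp divides k.\<close>

lemma prim_roots_mult_dvd:
  assumes "prime p" "p dvd m"
  shows "prim_roots (m * p) = {z::'a::field. z ^ p \<in> prim_roots m}"
proof (intro Set.set_eqI iffI; simp)
  fix z :: 'a assume "z \<in> prim_roots (m * p)"
  then show "z ^ p \<in> prim_roots m" using assms by (intro power_mem_prim_roots prime_gt_0_nat)
next
  fix z :: 'a assume *: "z ^ p \<in> prim_roots m"
  have "z ^ k = 1 \<longleftrightarrow> m * p dvd k" for k
  proof
    assume k: "z ^ k = 1"
    then have "(z ^ p) ^ k = 1" by (metis power_mult mult.commute power_one)
    then have "m dvd k" using * by (simp add: prim_rootsD)
    then obtain j where "k = p * j" using assms(2) by (metis dvd_trans dvdE)
    with k have "(z ^ p) ^ j = 1" by (simp add: power_mult)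
    then have "m dvd j" using * by (simp add: prim_rootsD)
    then show "m * p dvd k" using \<open>k = p * j\<close> by auto
  next
    assume "m * p dvd k"
    then obtain j where "k = p * (m * j)" by (metis dvdE mult.assoc mult.commute)
    then show "z ^ k = 1" using prim_rootsD[OF *, of "m * j"] by (simp add: power_mult)
  qed
  then show "z \<in> prim_roots (m * p)" by (simp add: prim_roots_def)
qed

text \<open>If z^p has order m, the order of z is a multiple of m dividing mp, hence m or mp.
  Conversely, raising to the power p preserves the order m because p is coprime to m.\<close>

lemma prim_roots_mult_coprime:
  assumes "prime p" "\<not> p dvd m"
  shows "{z::'a::field. z ^ p \<in> prim_roots m} = prim_roots (m * p) \<union> prim_roots m"
    "prim_roots (m * p) \<inter> prim_roots m = ({} :: 'a set)"
proof -
  have "m > 0" using assms(2) by (auto intro!: gr0I)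
  then have "\<not> m * p dvd m" using prime_gt_1_nat[OF assms(1)] by (auto dest: dvd_imp_le)
  then show "prim_roots (m * p) \<inter> prim_roots m = ({} :: 'a set)"
    using prim_rootsD[where k = m] dvd_refl[of m] by blast
  show "{z::'a. z ^ p \<in> prim_roots m} = prim_roots (m * p) \<union> prim_roots m"
  proof (intro Set.set_eqI iffI)
    fix z :: 'a assume "z \<in> prim_roots (m * p) \<union> prim_roots m"
    then show "z \<in> {z. z ^ p \<in> prim_roots m}" using assms
      by (auto intro: power_mem_prim_roots prime_gt_0_nat power_coprime_mem_prim_roots prime_imp_coprime)
  next
    fix z :: 'a assume "z \<in> {z. z ^ p \<in> prim_roots m}"
    then have *: "z ^ p \<in> prim_roots m" by simp
    have m: "m dvd k" if "z ^ k = 1" for k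
      using that by (metis * power_mult mult.commute power_one prim_rootsD)
    have mp: "z ^ (m * p) = 1" using prim_rootsD[OF *, of m] by (metis dvd_refl power_mult mult.commute)
    show "z \<in> prim_roots (m * p) \<union> prim_roots m"
    proof (cases "z ^ m = 1")
      case True
      then have "z ^ k = 1 \<longleftrightarrow> m dvd k" for k using m[of k] by (auto simp: power_mult)
      then show ?thesis by (simp add: prim_roots_def)
    next
      case False
      have "m * p dvd k" if k: "z ^ k = 1" for k
      proof -
        obtain j where j: "k = m * j" using m[OF k] by auto
        have "p dvd j"
        proof (rule ccontr)
          assume "\<not> p dvd j"
          then have "coprime j p" using assms(1) by (metis prime_imp_coprime coprime_commute)
          moreover have "j \<noteq> 0" using \<open>\<not> p dvd j\<close> by (metis dvd_0_right)
          \<comment> \<open>Multiplied by m, this Bezout relation expresses z^m through powers of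
            z^(mj) and z^(mp), both of which are 1.\<close>
          ultimately obtain x y where "j * x = p * y + 1"
            using bezout_nat[of j p] by auto
          then have "m * j * x = m * p * y + m" by (metis distrib_left mult.assoc mult.right_neutral)
          then have "z ^ (m * j * x) = z ^ (m * p * y) * z ^ m" by (metis power_add)
          then have "z ^ m = 1" using k j mp by (simp add: power_mult)
          with False show False by simp
        qed
        then show ?thesis using j by simp
      qed
      moreover have "z ^ k = 1" if "m * p dvd k" for k
        using that mp by (metis dvdE power_mult power_one)
      ultimately have "z ^ k = 1 \<longleftrightarrow> m * p dvd k" for k by blast
      then show ?thesis by (simp add: prim_roots_def)
    qed
  qed
qed

text \<open>The quotient of two elements with equal k-th powers is killed by the coprime exponents k
  and n, so it is 1. Finiteness upgrades injectivity to bijectivity.\<close>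

lemma bij_betw_power_prim_roots:
  assumes "coprime k n" "n > 0"
  shows "bij_betw (\<lambda>z. z ^ k) (prim_roots n :: 'a::field set) (prim_roots n)"
proof -
  have "inj_on (\<lambda>z::'a. z ^ k) (prim_roots n)"
  proof (rule inj_onI)
    fix y z :: 'a assume yz: "y \<in> prim_roots n" "z \<in> prim_roots n" "y ^ k = z ^ k"
    have nz: "z \<noteq> 0" using yz assms prim_roots_nonzero by blast
    then have k: "(y / z) ^ k = 1" using yz by (simp add: power_divide)
    have n: "(y / z) ^ n = 1" using yz prim_rootsD[of y n n] prim_rootsD[of z n n] by (simp add: power_divide)
    show "y = z"
    proof (cases "k = 0")
      case True
      then have "n = 1" using assms by simp
      with n nz show ?thesis by simp
    next
      case False
      then obtain a b where "k * a = n * b + 1"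
        using bezout_nat[of k n] assms by auto
      then have "(y / z) ^ (k * a) = (y / z) ^ (n * b) * (y / z)" by (metis power_add power_one_right)
      then show ?thesis using k n nz by (simp add: power_mult)
    qed
  qed
  moreover have "(\<lambda>z::'a. z ^ k) ` prim_roots n \<subseteq> prim_roots n"
    using assms by (auto intro: power_coprime_mem_prim_roots)
  ultimately show ?thesis
    using endo_inj_surj[OF finite_prim_roots[OF assms(2)]] by (simp add: bij_betw_def)
qed

section \<open>Cyclotomic polynomials and the number of primitive roots\<close>

definition cyc :: "nat \<Rightarrow> 'a::field poly" where
  "cyc n = (\<Prod>z\<in>prim_roots n. [:-z, 1:])"

text \<open>Both sides are the product of $x^p - w$ over the primitive $m$-th roots of unity $w$.\<close>
lemma pcompose_cyc:
  fixes m p :: nat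
  assumes "m > 0" "p > 0"
  shows "pcompose (cyc m) (monom 1 p) =
    (\<Prod>z\<in>{z. z ^ p \<in> prim_roots m}. [:-z, 1::'a::{alg_closed_field,field_char_0}:])"
proof -
  have "[:-w:] + monom 1 p = monom 1 p - [:w::'a:]" for w
    by (simp add: poly_eq_iff coeff_pCons split: nat.splits)
  then have "pcompose (cyc m) (monom 1 p) = (\<Prod>w\<in>prim_roots m. monom 1 p - [:w::'a:])"
    by (simp only: cyc_def pcompose_prod pcompose_pCons pcompose_0 pcompose_1 mult_zero_right add_0_right mult_1_right flip: one_pCons)
  also have "\<dots> = (\<Prod>w\<in>prim_roots m. \<Prod>z\<in>{z. z ^ p = w}. [:-z, 1:])"
    using assms by (intro prod.cong prod_nth_roots prim_roots_nonzero) auto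
  also have "\<dots> = (\<Prod>z\<in>(\<Union>w\<in>prim_roots m. {z. z ^ p = w}). [:-z, 1:])"
    using assms by (intro prod.UNION_disjoint [symmetric] finite_prim_roots ballI finite_nth_roots) auto
  also have "(\<Union>w\<in>prim_roots m. {z. z ^ p = w}) = {z::'a. z ^ p \<in> prim_roots m}" by auto
  finally show ?thesis .
qed

lemma cyc_mult_dvd:
  assumes "prime p" "p dvd m" "m > 0"
  shows "cyc (m * p) = pcompose (cyc m) (monom 1 p :: 'a::{alg_closed_field,field_char_0} poly)"
  unfolding pcompose_cyc[OF assms(3) prime_gt_0_nat[OF assms(1)]]
  using prim_roots_mult_dvd[OF assms(1,2), where 'a = 'a] by (simp add: cyc_def)

lemma cyc_mult_coprime:
  assumes "prime p" "\<not> p dvd m" "m > 0"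
  shows "cyc (m * p) * cyc m = pcompose (cyc m) (monom 1 p :: 'a::{alg_closed_field,field_char_0} poly)"
proof -
  have "p > 0" using assms(1) by (rule prime_gt_0_nat)
  then show ?thesis
    unfolding pcompose_cyc[OF assms(3) \<open>p > 0\<close>] prim_roots_mult_coprime(1)[OF assms(1,2)]
    unfolding cyc_def using assms
    by (intro prod.union_disjoint [symmetric] finite_prim_roots prim_roots_mult_coprime(2)) simp_all
qed

lemma totient_mult_prime:
  assumes "prime p" "m > 0"
  shows "totient (m * p) = (if p dvd m then p * totient m else (p - 1) * totient m)"
proof (cases "p dvd m")
  case True
  then have "gcd m p = p" by (simp add: gcd_proj2_iff)
  with totient_gcd[of m p] True assms show ?thesis by (auto simp: prime_gt_0_nat)
next
  case False
  then have "coprime m p" using assms by (metis prime_imp_coprime coprime_commute)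
  then show ?thesis using False assms by (simp add: totient_mult_coprime totient_prime)
qed

text \<open>Peels off one prime at a time, matching the step from Phi_m to Phi_(mp); whether p
  divides m decides which composition identity applies.\<close>

lemma prime_divisor_induct [consumes 1, case_names one mult]:
  fixes n :: nat
  assumes "n > 0" "P 1" "\<And>m p. m > 0 \<Longrightarrow> prime p \<Longrightarrow> P m \<Longrightarrow> P (m * p)"
  shows "P n"
  using assms(1)
proof (induction n rule: less_induct)
  case (less n)
  show ?case
  proof (cases "n = 1")
    case False
    then obtain p where p: "prime p" "p dvd n" using prime_factor_nat by blast
    then obtain m where m: "n = m * p" by (metis dvdE mult.commute)
    have "P m" using less m p prime_gt_1_nat[of p] by auto
    then show ?thesis using m p less.prems assms(3)[of m p] by auto
  qed (use assms in auto)
qed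

text \<open>Comparing degrees in the composition identities gives the recursion of phi. Existence of
  primitive roots follows from this count.\<close>

lemma card_prim_roots:
  assumes "n > 0"
  shows "card (prim_roots n :: 'a::{alg_closed_field,field_char_0} set) = totient n"
  using assms
proof (induction n rule: prime_divisor_induct)
  case one
  then show ?case by (simp add: prim_roots_1)
next
  case (mult m p)
  have deg: "degree (cyc k :: 'a poly) = card (prim_roots k :: 'a set)" for k
    by (simp add: cyc_def degree_prod_linear)
  have deg': "degree (pcompose (cyc m) (monom (1::'a) p)) = totient m * p"
    using mult by (simp add: degree_pcompose deg degree_monom_eq)
  show ?case
  proof (cases "p dvd m")
    case True
    then show ?thesis using deg[of "m * p"] deg' mult by (simp add: cyc_mult_dvd totient_mult_prime mult.commute)
  next
    case False
    have "degree (cyc (m * p) * cyc m :: 'a poly) = degree (cyc (m * p) :: 'a poly) + degree (cyc m :: 'a poly)"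
      by (rule degree_mult_eq) (auto simp: cyc_def degree_prod_linear prod_zero_iff mult finite_prim_roots prime_gt_0_nat)
    then have "totient m * p = card (prim_roots (m * p) :: 'a set) + totient m"
      using deg' mult False by (simp add: cyc_mult_coprime deg)
    then show ?thesis using False mult prime_gt_0_nat[of p] by (simp add: totient_mult_prime algebra_simps)
  qed
qed

lemma prim_root_exists:
  assumes "n > 0"
  obtains z :: "'a::{alg_closed_field,field_char_0}" where "z \<in> prim_roots n"
proof -
  have "prim_roots n \<noteq> ({} :: 'a set)"
    using card_prim_roots[OF assms, where 'a = 'a] assms by auto
  then show ?thesis using that by blast
qed

section \<open>Differences of primitive roots of unity\<close>

lemma poly_cyc: "poly (cyc n) x = (\<Prod>z\<in>prim_roots n. x - z)"
  by (simp add: cyc_def poly_prod)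

lemma poly_pderiv_cyc:
  "n > 0 \<Longrightarrow> z \<in> prim_roots n \<Longrightarrow> poly (pderiv (cyc n)) z = (\<Prod>w\<in>prim_roots n - {z}. z - w)"
  unfolding cyc_def by (rule poly_pderiv_prod_linear[OF finite_prim_roots])

lemma poly_cyc_eq_0_iff: "n > 0 \<Longrightarrow> poly (cyc n) x = 0 \<longleftrightarrow> x \<in> prim_roots n"
  by (simp add: poly_cyc prod_zero_iff finite_prim_roots)

section \<open>Values of the cyclotomic polynomials at 1\<close>

lemma poly_cyc_1_prime_power:
  assumes "prime p"
  shows "poly (cyc (p ^ Suc k)) (1::'a::{alg_closed_field,field_char_0}) = of_nat p"
proof (induction k)
  case 0
  have p: "\<not> p dvd 1" "p > 0" using assms prime_gt_1_nat[of p] by auto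
  have *: "cyc (1 * p) * cyc 1 = pcompose (cyc 1) (monom (1::'a) p)"
    using assms p by (intro cyc_mult_coprime) auto
  have c1: "cyc 1 = [:-1, 1::'a:]" by (simp add: cyc_def prim_roots_1)
  \<comment> \<open>At 1 the identity itself only reads 0 = 0; its derivative there gives Phi_p(1) =
    p.\<close>
  from * have "poly (pderiv (cyc p * cyc 1)) 1 = poly (pderiv (pcompose (cyc 1) (monom (1::'a) p))) 1"
    by simp
  then show ?case
    by (simp add: c1[simplified] pderiv_mult pderiv_pcompose pderiv_pCons pderiv_monom poly_pcompose poly_monom del: mult_pCons_left mult_pCons_right)
next
  case (Suc k)
  have "cyc (p ^ Suc k * p) = pcompose (cyc (p ^ Suc k)) (monom (1::'a) p)"
    using assms prime_gt_0_nat by (intro cyc_mult_dvd) auto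
  then have "poly (cyc (p ^ Suc (Suc k))) (1::'a) = poly (cyc (p ^ Suc k)) 1"
    by (simp add: poly_pcompose poly_monom mult_ac)
  with Suc show ?case by simp
qed

text \<open>If p | m, then m is not a prime power either and the value at 1 is inherited. Otherwise
  Phi_(mp)(1) Phi_m(1) = Phi_m(1), and Phi_m(1) can be cancelled because m > 1.\<close>

lemma poly_cyc_1_not_prime_power:
  assumes "n > 1" "\<nexists>p k. prime p \<and> n = p ^ Suc k"
  shows "poly (cyc n) (1::'a::{alg_closed_field,field_char_0}) = 1"
proof -
  have "n > 0" using assms by simp
  then show ?thesis using assms
  proof (induction n rule: prime_divisor_induct)
    case one
    then show ?case by simp
  next
    case (mult m p)
    have m1: "m > 1"
    proof (rule ccontr)
      assume "\<not> m > 1"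
      with mult have "prime p \<and> m * p = p ^ Suc 0" by simp
      with mult.prems show False by blast
    qed
    show ?case
    proof (cases "p dvd m")
      case True
      have "\<nexists>q k. prime q \<and> m = q ^ Suc k"
      proof
        assume "\<exists>q k. prime q \<and> m = q ^ Suc k"
        then obtain q k where q: "prime q" "m = q ^ Suc k" by blast
        then have "p = q" using True mult(2) by (metis prime_dvd_power_nat primes_dvd_imp_eq)
        with q have "prime p \<and> m * p = p ^ Suc (Suc k)" by simp
        with mult.prems show False by blast
      qed
      then show ?thesis using mult m1 True by (simp add: cyc_mult_dvd poly_pcompose poly_monom)
    next
      case False
      have "poly (cyc (m * p) * cyc m) (1::'a) = poly (cyc m) 1"
        unfolding cyc_mult_coprime[OF mult(2) False mult(1)] by (simp add: poly_pcompose poly_monom)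
      moreover have "poly (cyc m) (1::'a) \<noteq> 0"
        using m1 by (simp add: poly_cyc_eq_0_iff one_notin_prim_roots)
      ultimately show ?thesis by simp
    qed
  qed
qed

text \<open>Up to sign, the discriminant of $\Phi_n$.\<close>
definition cyc_diffs :: "nat \<Rightarrow> 'a::field" where
  "cyc_diffs n = (\<Prod>z\<in>prim_roots n. poly (pderiv (cyc n)) z)"

lemma poly_pderiv_pcompose_monom:
  "poly (pderiv (pcompose f (monom (1::'a::idom) p))) z = of_nat p * z ^ (p - 1) * poly (pderiv f) (z ^ p)"
  by (simp add: pderiv_pcompose poly_pcompose pderiv_monom poly_monom)

text \<open>Each w has exactly p roots of order p in the field, so every factor \<open>g w\<close>
  occurs p times.\<close>

lemma prod_prim_roots_fibres:
  fixes g :: "'a::{alg_closed_field,field_char_0} \<Rightarrow> 'b::comm_semiring_1"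
  assumes "m > 0" "p > 0"
  shows "(\<Prod>z\<in>{z. z ^ p \<in> prim_roots m}. g (z ^ p)) = (\<Prod>w\<in>prim_roots m. g w) ^ p"
proof -
  have "(\<Prod>z\<in>{z. z ^ p \<in> prim_roots m}. g (z ^ p)) =
      (\<Prod>z\<in>(\<Union>w\<in>prim_roots m. {z. z ^ p = w}). g (z ^ p))" by (rule prod.cong) auto
  also have "\<dots> = (\<Prod>w\<in>prim_roots m. \<Prod>z\<in>{z. z ^ p = w}. g (z ^ p))"
    using assms by (intro prod.UNION_disjoint finite_prim_roots ballI finite_nth_roots) auto
  also have "\<dots> = (\<Prod>w\<in>prim_roots m. g w ^ p)"
    using assms by (intro prod.cong refl) (simp add: card_nth_roots prim_roots_nonzero)
  finally show ?thesis by (simp only: prod_power_distrib)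
qed

section \<open>Totatives and the product of all primitive roots\<close>

lemma bij_betw_totatives_prim_roots:
  fixes z :: "'a::{alg_closed_field,field_char_0}"
  assumes "z \<in> prim_roots n" "n > 0"
  shows "bij_betw (\<lambda>k. z ^ k) (totatives n) (prim_roots n)"
proof -
  have nz: "z \<noteq> 0" using assms prim_roots_nonzero by blast
  have "inj_on (\<lambda>k. z ^ k) (totatives n)"
  proof (rule linorder_inj_onI)
    fix j k assume jk: "j < k" "j \<in> totatives n" "k \<in> totatives n"
    have "\<not> n dvd k - j" using jk by (auto simp: in_totatives_iff dest: dvd_imp_le)
    then have "z ^ (k - j) \<noteq> 1" using prim_rootsD[OF assms(1)] by simp
    then show "z ^ j \<noteq> z ^ k" using jk nz by (auto simp: power_diff)
  qed auto
  moreover have "(\<lambda>k. z ^ k) ` totatives n \<subseteq> prim_roots n"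
    using assms by (auto simp: in_totatives_iff intro: power_coprime_mem_prim_roots)
  ultimately have "(\<lambda>k. z ^ k) ` totatives n = prim_roots n"
    using assms(2) by (intro card_subset_eq finite_prim_roots) (simp_all add: card_image card_prim_roots totient_def)
  with \<open>inj_on _ _\<close> show ?thesis by (simp add: bij_betw_def)
qed

text \<open>This reflection corresponds to inversion of the primitive n-th roots. It fails for n =
  1, whose only totative is 1 itself.\<close>

lemma bij_betw_totatives_diff:
  assumes "n > 1"
  shows "bij_betw (\<lambda>k. n - k) (totatives n) (totatives n)"
proof (rule bij_betwI[of _ _ _ "\<lambda>k. n - k"])
  have "n - k \<in> totatives n" if "k \<in> totatives n" for k
  proof -
    have "k < n" using totatives_less[OF that assms] .
    have "gcd (n - k) n = gcd k n"
      using gcd_diff2_nat[of k n] \<open>k < n\<close> by (simp add: gcd.commute)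
    then have "coprime (n - k) n" using that by (simp only: in_totatives_iff coprime_iff_gcd_eq_1)
    with \<open>k < n\<close> show ?thesis by (simp add: in_totatives_iff)
  qed
  then show "(\<lambda>k. n - k) \<in> totatives n \<rightarrow> totatives n" "(\<lambda>k. n - k) \<in> totatives n \<rightarrow> totatives n"
    by auto
qed (auto simp: in_totatives_iff)

lemma sum_totatives:
  assumes "n > 1"
  shows "2 * (\<Sum>k\<in>totatives n. k) = n * totient n"
proof -
  have "(\<Sum>k\<in>totatives n. k) = (\<Sum>k\<in>totatives n. n - k)"
    using sum.reindex_bij_betw[OF bij_betw_totatives_diff[OF assms], of "\<lambda>k. k"] by simp
  then have "2 * (\<Sum>k\<in>totatives n. k) = (\<Sum>k\<in>totatives n. k + (n - k))"
    by (simp add: sum.distrib)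
  also have "\<dots> = (\<Sum>k\<in>totatives n. n)" by (rule sum.cong) (auto simp: in_totatives_iff)
  finally show ?thesis by (simp add: totient_def)
qed

lemma prod_prim_roots_power:
  assumes "z \<in> prim_roots n" "n > 0"
  shows "(\<Prod>z\<in>prim_roots n. z) = (z::'a::{alg_closed_field,field_char_0}) ^ (\<Sum>k\<in>totatives n. k)"
  using prod.reindex_bij_betw[OF bij_betw_totatives_prim_roots[OF assms], of "\<lambda>z. z"]
  by (simp add: power_sum)

text \<open>The product is z^s with s the sum of the totatives, and 2s = n phi(n). For n > 2, s
  itself is a multiple of n; for n = 2 the product is -1.\<close>

lemma prod_prim_roots_square:
  assumes "n > 1"
  shows "(\<Prod>z\<in>prim_roots n. z) ^ 2 = (1::'a::{alg_closed_field,field_char_0})"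
proof -
  obtain z :: 'a where z: "z \<in> prim_roots n" using prim_root_exists[of n] assms by auto
  have "(\<Prod>z\<in>prim_roots n. z) ^ 2 = z ^ (2 * (\<Sum>k\<in>totatives n. k))"
    using prod_prim_roots_power[OF z] assms by (simp add: mult.commute flip: power_mult)
  also have "\<dots> = 1" using prim_rootsD[OF z] assms by (simp add: sum_totatives)
  finally show ?thesis .
qed

lemma prod_prim_roots:
  assumes "n > 2"
  shows "(\<Prod>z\<in>prim_roots n. z) = (1::'a::{alg_closed_field,field_char_0})"
proof -
  obtain z :: 'a where z: "z \<in> prim_roots n" using prim_root_exists[of n] assms by auto
  obtain t where t: "totient n = 2 * t" using totient_even[OF assms] by auto
  then have "(\<Sum>k\<in>totatives n. k) = n * t" using sum_totatives[of n] assms by simp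
  then show ?thesis using prod_prim_roots_power[OF z] prim_rootsD[OF z, of "n * t"] assms by simp
qed

section \<open>Recursion for the cyclotomic discriminant\<close>

text \<open>Multiply the chain rule p z^(p-1) Phi_m'(z^p) over the roots z of Phi_(mp): the powers
  of z multiply to 1 and each value of Phi_m' occurs p times.\<close>

lemma cyc_diffs_mult_dvd:
  assumes "prime p" "p dvd m" "m > 0" "m * p > 2"
  shows "cyc_diffs (m * p) = of_nat p ^ totient (m * p) * (cyc_diffs m :: 'a::{alg_closed_field,field_char_0}) ^ p"
proof -
  have p: "p > 0" using assms(1) by (rule prime_gt_0_nat)
  have "cyc_diffs (m * p) = (\<Prod>z\<in>prim_roots (m * p). of_nat p * z ^ (p - 1) * poly (pderiv (cyc m)) ((z::'a) ^ p))"
    unfolding cyc_diffs_def cyc_mult_dvd[OF assms(1-3)] poly_pderiv_pcompose_monom ..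
  also have "\<dots> = of_nat p ^ totient (m * p) * (\<Prod>z\<in>prim_roots (m * p). z) ^ (p - 1) *
      (\<Prod>z\<in>prim_roots (m * p). poly (pderiv (cyc m)) ((z::'a) ^ p))"
    using assms p by (simp add: prod.distrib card_prim_roots prod_power_distrib)
  also have "(\<Prod>z\<in>prim_roots (m * p). poly (pderiv (cyc m)) ((z::'a) ^ p)) = cyc_diffs m ^ p"
    unfolding prim_roots_mult_dvd[OF assms(1,2)] cyc_diffs_def using assms p by (intro prod_prim_roots_fibres)
  finally show ?thesis using assms by (simp add: prod_prim_roots)
qed

text \<open>Symmetry of the resultant of Phi_m and Phi_n: exchanging them changes the sign of every
  factor z - w.\<close>

lemma prod_cyc_swap:
  "(\<Prod>z\<in>prim_roots m. poly (cyc n) z) =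
    (-1) ^ (card (prim_roots n :: 'a set) * card (prim_roots m :: 'a set)) * (\<Prod>w\<in>prim_roots n. poly (cyc m) (w::'a::field))"
proof -
  have "(\<Prod>z\<in>prim_roots m. poly (cyc n) z) = (\<Prod>z\<in>prim_roots m. \<Prod>w\<in>prim_roots n. z - (w::'a))"
    by (simp add: poly_cyc)
  also have "\<dots> = (\<Prod>w\<in>prim_roots n. \<Prod>z\<in>prim_roots m. -1 * (w - z))"
    by (subst prod.swap) simp
  also have "\<dots> = (\<Prod>w\<in>prim_roots n. (-1) ^ card (prim_roots m :: 'a set) * poly (cyc m) w)"
    by (simp only: prod.distrib poly_cyc prod_constant)
  finally show ?thesis by (simp add: prod.distrib power_mult mult.commute)
qed

lemma cyc_diffs_nonzero: "n > 0 \<Longrightarrow> cyc_diffs n \<noteq> (0::'a::field)"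
  by (simp add: cyc_diffs_def prod_zero_iff finite_prim_roots poly_pderiv_cyc)

text \<open>Differentiating Phi_(mp)(x) Phi_m(x) = Phi_m(x^p) at a root w of Phi_m leaves
  Phi_(mp)(w) Phi_m'(w). Since w -> w^p permutes these roots, the values of Phi_m' cancel in the
  product.\<close>

lemma prod_cyc_mult_prime:
  assumes "prime p" "\<not> p dvd m" "m > 0"
  shows "(\<Prod>w\<in>prim_roots m. poly (cyc (m * p)) w) =
    of_nat p ^ totient m * (\<Prod>w\<in>prim_roots m. w::'a::{alg_closed_field,field_char_0}) ^ (p - 1)"
proof -
  have cop: "coprime p m" using assms by (metis prime_imp_coprime)
  have "poly (cyc (m * p)) w * poly (pderiv (cyc m)) w = of_nat p * w ^ (p - 1) * poly (pderiv (cyc m)) (w ^ p)"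
    if "w \<in> prim_roots m" for w :: 'a
  proof -
    have "poly (pderiv (cyc (m * p) * cyc m)) w = of_nat p * w ^ (p - 1) * poly (pderiv (cyc m)) (w ^ p)"
      unfolding cyc_mult_coprime[OF assms] poly_pderiv_pcompose_monom ..
    moreover have "poly (cyc m) w = 0" using that assms(3) by (simp add: poly_cyc_eq_0_iff)
    ultimately show ?thesis by (simp add: pderiv_mult)
  qed
  then have "(\<Prod>w\<in>prim_roots m. poly (cyc (m * p)) w) * cyc_diffs m =
    (\<Prod>w\<in>prim_roots m. of_nat p * w ^ (p - 1) * poly (pderiv (cyc m)) ((w::'a) ^ p))"
    unfolding cyc_diffs_def by (simp flip: prod.distrib)
  also have "\<dots> = of_nat p ^ totient m * (\<Prod>w\<in>prim_roots m. w) ^ (p - 1) *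
      (\<Prod>w\<in>prim_roots m. poly (pderiv (cyc m)) ((w::'a) ^ p))"
    using assms by (simp add: prod.distrib card_prim_roots prod_power_distrib)
  also have "(\<Prod>w\<in>prim_roots m. poly (pderiv (cyc m)) ((w::'a) ^ p)) = cyc_diffs m"
    unfolding cyc_diffs_def using bij_betw_power_prim_roots[OF cop assms(3)]
    by (rule prod.reindex_bij_betw)
  finally show ?thesis using cyc_diffs_nonzero[OF assms(3), where 'a = 'a] by simp
qed

text \<open>The same differentiated identity, now at the roots z of Phi_(mp), leaves Phi_m(z)
  Phi_(mp)'(z). The product of the Phi_m(z) is the resultant and supplies the power of p on the
  left.\<close>

lemma cyc_diffs_mult_coprime:
  assumes "prime p" "\<not> p dvd m" "m > 0" "m * p > 2"
  shows "of_nat p ^ totient m * cyc_diffs (m * p) =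
    of_nat p ^ totient (m * p) * (cyc_diffs m :: 'a::{alg_closed_field,field_char_0}) ^ (p - 1)"
proof -
  have p: "p > 0" using assms(1) by (rule prime_gt_0_nat)
  have fin: "finite (prim_roots (m * p) :: 'a set)" "finite (prim_roots m :: 'a set)"
    using assms p by (simp_all add: finite_prim_roots)
  \<comment> \<open>For m = 2 the product of the roots is -1, but then p is odd and the exponent
    even.\<close>
  have one: "(\<Prod>w\<in>prim_roots m. w::'a) ^ (p - 1) = 1"
  proof (cases "m > 2")
    case False
    then consider "m = 1" | "m = 2" using assms by linarith
    then show ?thesis
    proof cases
      case 1 then show ?thesis by (simp add: prim_roots_1)
    next
      case 2
      then have "p \<noteq> 2" using assms(2) by auto
      then have "even (p - 1)" using assms(1) prime_odd_nat prime_ge_2_nat[of p] by (auto simp: order_less_le)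
      then obtain t where "p - 1 = 2 * t" by (elim evenE)
      then show ?thesis using prod_prim_roots_square[of m, where 'a = 'a] 2 by (simp add: power_mult)
    qed
  qed (simp add: prod_prim_roots)
  have "poly (cyc m) z * poly (pderiv (cyc (m * p))) z = of_nat p * z ^ (p - 1) * poly (pderiv (cyc m)) (z ^ p)"
    if "z \<in> prim_roots (m * p)" for z :: 'a
  proof -
    have "poly (pderiv (cyc (m * p) * cyc m)) z = of_nat p * z ^ (p - 1) * poly (pderiv (cyc m)) (z ^ p)"
      unfolding cyc_mult_coprime[OF assms(1-3)] poly_pderiv_pcompose_monom ..
    moreover have "poly (cyc (m * p)) z = 0" using that assms(3) p by (simp add: poly_cyc_eq_0_iff)
    ultimately show ?thesis by (simp add: pderiv_mult)
  qed
  then have "(\<Prod>z\<in>prim_roots (m * p). poly (cyc m) z) * cyc_diffs (m * p) =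
    (\<Prod>z\<in>prim_roots (m * p). of_nat p * z ^ (p - 1) * poly (pderiv (cyc m)) ((z::'a) ^ p))"
    unfolding cyc_diffs_def by (simp flip: prod.distrib)
  also have "\<dots> = of_nat p ^ totient (m * p) * (\<Prod>z\<in>prim_roots (m * p). z) ^ (p - 1) *
      (\<Prod>z\<in>prim_roots (m * p). poly (pderiv (cyc m)) ((z::'a) ^ p))"
    using assms p by (simp add: prod.distrib card_prim_roots prod_power_distrib)
  also have "(\<Prod>z\<in>prim_roots (m * p). z) = (1::'a)" using assms by (simp add: prod_prim_roots)
  \<comment> \<open>The full fibres give p copies of \<open>cyc_diffs m\<close>; one of them belongs
    to the z of order m, which z -> z^p permutes.\<close>
  also have "(\<Prod>z\<in>prim_roots (m * p). poly (pderiv (cyc m)) ((z::'a) ^ p)) = cyc_diffs m ^ (p - 1)"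
  proof -
    have "(\<Prod>z\<in>prim_roots (m * p). poly (pderiv (cyc m)) ((z::'a) ^ p)) *
      (\<Prod>z\<in>prim_roots m. poly (pderiv (cyc m)) ((z::'a) ^ p)) =
      (\<Prod>z\<in>prim_roots (m * p) \<union> prim_roots m. poly (pderiv (cyc m)) ((z::'a) ^ p))"
      using fin prim_roots_mult_coprime(2)[OF assms(1,2)] by (rule prod.union_disjoint[symmetric])
    also have "\<dots> = cyc_diffs m ^ p"
      unfolding prim_roots_mult_coprime(1)[OF assms(1,2), symmetric] cyc_diffs_def
      using assms p by (intro prod_prim_roots_fibres)
    also have "\<dots> = cyc_diffs m ^ (p - 1) * cyc_diffs m"
      using p by (metis power_minus_mult)
    also have "(\<Prod>z\<in>prim_roots m. poly (pderiv (cyc m)) ((z::'a) ^ p)) = cyc_diffs m"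
      unfolding cyc_diffs_def
      by (rule prod.reindex_bij_betw[OF bij_betw_power_prim_roots[OF prime_imp_coprime[OF assms(1,2)] assms(3)]])
    finally show ?thesis using cyc_diffs_nonzero[OF assms(3), where 'a = 'a] by simp
  qed
  \<comment> \<open>The sign of the swap is trivial since phi(mp) is even.\<close>
  also have "(\<Prod>z\<in>prim_roots (m * p). poly (cyc m) (z::'a)) = of_nat p ^ totient m"
    using totient_even[OF assms(4)] assms p
    by (subst prod_cyc_swap) (simp add: prod_cyc_mult_prime one[simplified] card_prim_roots)
  finally show ?thesis by simp
qed

section \<open>The closed form of the cyclotomic discriminant\<close>

text \<open>Up to sign, n^phi(n) divided by this number is the discriminant of Phi_n, see
  \<open>cyc_diffs_eq\<close>. The quotients in the exponents are exact because p - 1 = phi(p)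
  divides phi(n).\<close>

definition disc_denom :: "nat \<Rightarrow> nat" where
  "disc_denom n = (\<Prod>p\<in>prime_factors n. p ^ (totient n div (p - 1)))"

lemma prime_minus_one_dvd_totient:
  assumes "p \<in> prime_factors n"
  shows "p - 1 dvd totient n"
proof -
  have "prime p" "p dvd n" using assms by (simp_all add: in_prime_factors_iff)
  then show ?thesis using totient_dvd[of p n] by (simp add: totient_prime)
qed

lemma disc_denom_mult_dvd:
  assumes "prime p" "p dvd m" "m > 0"
  shows "disc_denom (m * p) = disc_denom m ^ p"
proof -
  have "prime_factors (m * p) = prime_factors m"
    using assms dvd_trans[of _ p m] by (auto simp: in_prime_factors_iff prime_dvd_mult_iff)
  then have "disc_denom (m * p) = (\<Prod>q\<in>prime_factors m. (q ^ (totient m div (q - 1))) ^ p)"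
    unfolding disc_denom_def
  proof (rule prod.cong)
    fix q assume "q \<in> prime_factors m"
    then have "totient (m * p) div (q - 1) = totient m div (q - 1) * p"
      using assms prime_minus_one_dvd_totient[of q m]
      by (simp add: totient_mult_prime dvd_div_mult mult.commute[of p])
    then show "q ^ (totient (m * p) div (q - 1)) = (q ^ (totient m div (q - 1))) ^ p"
      by (simp add: power_mult)
  qed
  then show ?thesis by (simp only: prod_power_distrib disc_denom_def)
qed

text \<open>As phi(mp) = (p-1) phi(m), the exponents of the old primes grow by the factor p - 1. The
  new prime brings p^phi(m), the power that \<open>cyc_diffs_mult_coprime\<close> has on its
  left.\<close>

lemma disc_denom_mult_coprime:
  assumes "prime p" "\<not> p dvd m" "m > 0"
  shows "disc_denom (m * p) = p ^ totient m * disc_denom m ^ (p - 1)"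
proof -
  have "prime_factors (m * p) = insert p (prime_factors m)"
    using assms by (auto simp: in_prime_factors_iff prime_dvd_mult_iff primes_dvd_imp_eq)
  moreover have "p \<notin> prime_factors m" using assms by (auto simp: in_prime_factors_iff)
  moreover have "(\<Prod>q\<in>prime_factors m. q ^ (totient (m * p) div (q - 1))) =
    (\<Prod>q\<in>prime_factors m. (q ^ (totient m div (q - 1))) ^ (p - 1))"
  proof (rule prod.cong)
    fix q assume "q \<in> prime_factors m"
    then have "totient (m * p) div (q - 1) = totient m div (q - 1) * (p - 1)"
      using assms prime_minus_one_dvd_totient[of q m]
      by (simp add: totient_mult_prime dvd_div_mult mult.commute[of "p - Suc 0"])
    then show "q ^ (totient (m * p) div (q - 1)) = (q ^ (totient m div (q - 1))) ^ (p - 1)"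
      by (simp add: power_mult)
  qed simp
  moreover have "totient (m * p) div (p - 1) = totient m"
    using assms prime_gt_1_nat[of p] by (simp add: totient_mult_prime)
  ultimately show ?thesis by (simp add: disc_denom_def prod_power_distrib)
qed

lemma cyc_diffs_eq:
  assumes "n > 0"
  shows "cyc_diffs n * of_nat (disc_denom n) = (of_nat n ^ totient n :: 'a::{alg_closed_field,field_char_0})"
  using assms
proof (induction n rule: prime_divisor_induct)
  case one
  then show ?case by (simp add: disc_denom_def cyc_diffs_def cyc_def prim_roots_1 pderiv_pCons)
next
  case (mult m p)
  have p: "p > 1" using mult(2) by (rule prime_gt_1_nat)
  show ?case
  proof (cases "m * p > 2")
    \<comment> \<open>Only n = 2 escapes the recursions, because there the product of the primitive
      roots is not 1.\<close>
    case False
    then have "m * p \<le> 2" by simp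
    moreover have "m * 2 \<le> m * p" using p by simp
    ultimately have "m = 1" using mult(1) by linarith
    with \<open>m * p \<le> 2\<close> p have "p = 2" by simp
    with \<open>m = 1\<close>
    have 2: "m * p = 2" by simp
    have "card (prim_roots 2 :: 'a set) = 1" by (simp add: card_prim_roots)
    then obtain z :: 'a where z: "prim_roots 2 = {z}" by (auto simp: card_1_singleton_iff)
    have "prime_factors (2::nat) = {2}" by (simp add: prime_prime_factors)
    then show ?thesis unfolding 2
      by (simp add: disc_denom_def cyc_diffs_def cyc_def z pderiv_pCons)
  next
    case True
    show ?thesis
    proof (cases "p dvd m")
      case dvd: True
      have "cyc_diffs (m * p) * of_nat (disc_denom (m * p)) =
        of_nat p ^ totient (m * p) * (cyc_diffs m * of_nat (disc_denom m) :: 'a) ^ p"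
        using mult(1,2) dvd True by (simp add: cyc_diffs_mult_dvd disc_denom_mult_dvd power_mult_distrib)
      also have "\<dots> = of_nat (m * p) ^ totient (m * p)"
        unfolding mult.IH using mult dvd
        by (simp add: totient_mult_prime power_mult_distrib mult_ac flip: power_mult)
      finally show ?thesis .
    next
      case ndvd: False
      have "cyc_diffs (m * p) * of_nat (disc_denom (m * p)) =
        (of_nat p ^ totient m * cyc_diffs (m * p)) * of_nat (disc_denom m) ^ (p - 1)"
        using mult(1,2) ndvd by (simp add: disc_denom_mult_coprime)
      also have "\<dots> = of_nat p ^ totient (m * p) * (cyc_diffs m * of_nat (disc_denom m) :: 'a) ^ (p - 1)"
        using mult(1,2) ndvd True by (simp add: cyc_diffs_mult_coprime power_mult_distrib)
      also have "\<dots> = of_nat (m * p) ^ totient (m * p)"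
        unfolding mult.IH using mult ndvd
        by (simp add: totient_mult_prime power_mult_distrib mult_ac flip: power_mult)
      finally show ?thesis .
    qed
  qed
qed

section \<open>Roots of the Fibonacci and fibotomic polynomials\<close>

abbreviation ipoly :: "int poly \<Rightarrow> 'a::field_char_0 poly" where
  "ipoly \<equiv> map_poly of_int"

lemma ipoly_add: "ipoly (f + g) = ipoly f + ipoly g"
  by (simp add: poly_eq_iff coeff_map_poly)

lemma ipoly_mult: "ipoly (f * g) = ipoly f * ipoly g"
  by (simp add: poly_eq_iff coeff_map_poly coeff_mult)

lemma ipoly_prod: "ipoly (prod f A) = (\<Prod>x\<in>A. ipoly (f x))"
  by (induction A rule: infinite_finite_induct) (simp_all add: ipoly_mult)

lemma degree_ipoly: "degree (ipoly f :: 'a::field_char_0 poly) = degree f"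
  by (rule degree_map_poly) simp

lemma lead_coeff_ipoly: "lead_coeff (ipoly f :: 'a::field_char_0 poly) = of_int (lead_coeff f)"
  by (simp add: degree_ipoly coeff_map_poly)

lemma ipoly_dvd: "f dvd g \<Longrightarrow> ipoly f dvd (ipoly g :: 'a::field_char_0 poly)"
  by (auto simp: ipoly_mult elim!: dvdE)

text \<open>Over Z a minimal polynomial works only up to constants: pseudo-division by some g of
  least degree with root r shows that g divides a nonzero constant multiple of every h vanishing at
  r. The prime q has positive degree and divides no such constant, so q | g, and g | b f yields q |
  f.\<close>

lemma irreducible_dvd_if_common_root:
  fixes q f :: "int poly" and r :: "'a::field_char_0"
  assumes q: "irreducible q" "poly (ipoly q) r = 0" and f: "poly (ipoly f) r = 0"
  shows "q dvd f"
proof -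
  have prime: "prime_elem q" using q(1) by (rule irreducible_imp_prime_elem)
  have "q \<noteq> 0" using q(1) by auto
  have const: "degree h > 0" if "h \<noteq> 0" "poly (ipoly h) r = 0" for h
  proof (rule ccontr)
    assume "\<not> degree h > 0"
    then obtain c where "h = [:c:]" by (metis degree_eq_zeroE gr0I)
    with that show False by (simp add: map_poly_pCons)
  qed
  define P where "P = (\<lambda>h. h \<noteq> 0 \<and> poly (ipoly h) r = 0)"
  have "P q" using q \<open>q \<noteq> 0\<close> by (simp add: P_def)
  then obtain g where g: "P g" and min: "\<And>h. P h \<Longrightarrow> degree g \<le> degree h"
    using ex_has_least_nat[of P q degree] by blast
  have "g \<noteq> 0" using g by (simp add: P_def)
  have multiple: "\<exists>a s. a \<noteq> 0 \<and> smult a h = g * s" if h: "poly (ipoly h) r = 0" for h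
  proof -
    obtain a s where as: "a \<noteq> 0" "smult a h = g * s + pseudo_mod h g"
      using pseudo_mod(1)[OF \<open>g \<noteq> 0\<close>] by blast
    have "poly (ipoly (smult a h)) r = poly (ipoly g * ipoly s + ipoly (pseudo_mod h g)) r"
      unfolding as by (simp add: ipoly_add ipoly_mult)
    then have "poly (ipoly (pseudo_mod h g)) r = 0"
      using h g by (simp add: map_poly_smult P_def)
    then have "pseudo_mod h g = 0"
      using min[of "pseudo_mod h g"] pseudo_mod(2)[OF \<open>g \<noteq> 0\<close>, of h]
      unfolding P_def by linarith
    with as show ?thesis by auto
  qed
  have not_const: "\<not> q dvd [:a:]" if "a \<noteq> 0" for a
  proof
    assume "q dvd [:a:]"
    then have "degree q \<le> degree [:a:]" using that by (intro dvd_imp_degree_le) auto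
    with const[OF \<open>q \<noteq> 0\<close> q(2)] show False by simp
  qed
  obtain a s where as: "a \<noteq> 0" "smult a q = g * s" using multiple[OF q(2)] by blast
  have "q dvd g * s" unfolding as(2)[symmetric] by (simp add: dvd_smult)
  \<comment> \<open>Otherwise cancelling q would make g divide a nonzero constant, although g has a
    root and hence positive degree.\<close>
  moreover have "\<not> q dvd s"
  proof
    assume "q dvd s"
    then obtain t where "s = q * t" by (elim dvdE)
    with as(2) have "q * [:a:] = q * (g * t)" by (simp add: mult_ac)
    then have "[:a:] = g * t" using \<open>q \<noteq> 0\<close> by (metis mult_cancel_left)
    then have "g dvd [:a:]" by simp
    then have "degree g \<le> degree [:a:]" using as(1) by (intro dvd_imp_degree_le) auto
    with const[of g] g show False by (simp add: P_def)
  qed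
  ultimately have "q dvd g" using prime by (simp add: prime_elem_dvd_mult_iff)
  obtain b t where bt: "b \<noteq> 0" "smult b f = g * t" using multiple[OF f] by blast
  have "q dvd [:b:] * f" using \<open>q dvd g\<close> bt(2) by simp
  then show ?thesis using prime not_const[OF bt(1)] prime_elem_dvd_mult_iff by blast
qed

lemma fibpoly_monic: "degree (fibpoly (Suc n)) = n \<and> lead_coeff (fibpoly (Suc n)) = 1"
proof (induction n rule: induct_nat_012)
  case (ge2 n)
  let ?f = "fibpoly (Suc (Suc n))"
  have nz: "?f \<noteq> 0" using ge2 by auto
  have d: "degree ([:0, 1:] * ?f) = Suc (Suc n)"
    using ge2 nz by (subst degree_mult_eq) auto
  have lt: "degree (fibpoly (Suc n)) < degree ([:0, 1:] * ?f)" using d ge2 by simp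
  have "fibpoly (Suc (Suc (Suc n))) = [:0, 1:] * ?f + fibpoly (Suc n)" by simp
  moreover have "degree ([:0, 1:] * ?f + fibpoly (Suc n)) = Suc (Suc n)"
    using lt d by (simp only: degree_add_eq_left)
  moreover have "lead_coeff ([:0, 1:] * ?f + fibpoly (Suc n)) = lead_coeff ([:0, 1:] * ?f)"
    using lead_coeff_add_le[OF lt] by (simp add: add.commute)
  moreover have "lead_coeff ([:0, 1:] * ?f) = 1"
  proof -
    have "lead_coeff ?f = 1" using ge2 by blast
    then show ?thesis unfolding lead_coeff_mult by simp
  qed
  ultimately show ?case by (simp del: fibpoly.simps)
qed auto

section \<open>A Binet formula for the Fibonacci polynomials\<close>

text \<open>For i^2 = -1 this is the x at which the characteristic polynomial t^2 - x t - 1 of the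
  recursion has the roots i w and i / w.\<close>

definition fib_root :: "'a::field_char_0 \<Rightarrow> 'a \<Rightarrow> 'a" where
  "fib_root i w = i * (w + inverse w)"

text \<open>With $w = e^{i\theta}$ this is $F_n(2i\cos\theta) = i^{n-1}\sin(n\theta)/\sin\theta$.\<close>
lemma poly_fibpoly_fib_root:
  fixes i w :: "'a::field_char_0"
  assumes "i ^ 2 = -1" "w \<noteq> 0"
  shows "poly (ipoly (fibpoly n)) (fib_root i w) * (i * (w - inverse w)) = i ^ n * (w ^ n - inverse w ^ n)"
proof (induction n rule: fibpoly.induct)
  case (3 n)
  let ?r = "fib_root i w" and ?F = "\<lambda>n. poly (ipoly (fibpoly n)) (fib_root i w)"
  have "?F (Suc (Suc n)) * (i * (w - inverse w)) =
      ?r * (?F (Suc n) * (i * (w - inverse w))) + ?F n * (i * (w - inverse w))"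
    by (simp add: ipoly_add ipoly_mult map_poly_pCons algebra_simps del: mult_pCons_left)
  also have "\<dots> = ?r * (i ^ Suc n * (w ^ Suc n - inverse w ^ Suc n)) + i ^ n * (w ^ n - inverse w ^ n)"
    by (simp only: 3)
  also have "\<dots> = i ^ 2 * i ^ n * ((w + inverse w) * (w ^ Suc n - inverse w ^ Suc n)) + i ^ n * (w ^ n - inverse w ^ n)"
    by (simp add: fib_root_def power2_eq_square algebra_simps)
  also have "(w + inverse w) * (w ^ Suc n - inverse w ^ Suc n) =
      w ^ Suc (Suc n) - inverse w ^ Suc (Suc n) + (w ^ n - inverse w ^ n)"
  proof -
    have "w * inverse w = 1" using assms(2) by simp
    then show ?thesis by (simp add: distrib_right right_diff_distrib) (metis (no_types) mult.assoc mult.commute mult.left_neutral)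
  qed
  also have "i ^ 2 * i ^ n * \<dots> + i ^ n * (w ^ n - inverse w ^ n) =
      i ^ 2 * i ^ n * (w ^ Suc (Suc n) - inverse w ^ Suc (Suc n))"
    using assms(1) by (simp add: algebra_simps)
  finally show ?case by (simp add: power2_eq_square mult_ac)
qed simp_all

lemma fibpoly_fib_root_eq_0_iff:
  fixes i w :: "'a::field_char_0"
  assumes "i ^ 2 = -1" "w \<noteq> 0" "w ^ 2 \<noteq> 1"
  shows "poly (ipoly (fibpoly n)) (fib_root i w) = 0 \<longleftrightarrow> w ^ (2 * n) = 1"
proof -
  have i: "i \<noteq> 0" using assms(1) by auto
  have "w - inverse w \<noteq> 0" using assms(2,3) by (auto simp: power2_eq_square field_simps)
  then have "poly (ipoly (fibpoly n)) (fib_root i w) = 0 \<longleftrightarrow> w ^ n - inverse w ^ n = 0"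
    using poly_fibpoly_fib_root[OF assms(1,2), of n] i by (metis mult_eq_0_iff power_not_zero)
  also have "\<dots> \<longleftrightarrow> w ^ (2 * n) = 1"
    using assms(2) by (simp add: power_inverse field_simps power_mult power2_eq_square flip: power_add)
  finally show ?thesis .
qed

lemma fib_root_diff:
  fixes i w :: "'a::field_char_0"
  assumes "w \<noteq> 0" "u \<noteq> 0"
  shows "fib_root i w - fib_root i u = i * inverse w * (w - u) * (w - inverse u)"
  using assms by (simp add: fib_root_def field_simps)

lemma totatives_subset_interval: "n \<ge> 2 \<Longrightarrow> totatives n \<subseteq> {0<..<n}"
  using totatives_less[of _ n] by (auto simp: in_totatives_iff)

context
  fixes i \<eta> :: "'a::{alg_closed_field,field_char_0}" and n :: nat
  assumes i: "i ^ 2 = -1" and \<eta>: "\<eta> \<in> prim_roots (2 * n)" and n: "n \<ge> 2"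
begin

lemma \<eta>_nonzero: "\<eta> \<noteq> 0" using \<eta> n prim_roots_nonzero[of \<eta> "2 * n"] by simp

text \<open>By \<open>fib_root_diff\<close>, equal values at j < k would force eta^(k-j) = 1 or
  eta^(j+k) = 1, but both exponents lie strictly between 0 and 2n.\<close>

lemma inj_on_fib_root: "inj_on (\<lambda>k. fib_root i (\<eta> ^ k)) {0<..<n}"
proof (rule linorder_inj_onI)
  fix j k assume jk: "j < k" "j \<in> {0<..<n}" "k \<in> {0<..<n}"
  have "\<not> 2 * n dvd k - j" "\<not> 2 * n dvd j + k" using jk by (auto dest!: dvd_imp_le)
  then have *: "\<eta> ^ (k - j) \<noteq> 1" "\<eta> ^ (j + k) \<noteq> 1" using prim_rootsD[OF \<eta>] by auto
  have "\<eta> ^ j \<noteq> \<eta> ^ k" using *(1) jk \<eta>_nonzero by (auto simp: power_diff)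
  moreover have "\<eta> ^ j \<noteq> inverse (\<eta> ^ k)" using *(2) \<eta>_nonzero by (auto simp: power_add field_simps)
  moreover have "i \<noteq> 0" using i by auto
  ultimately show "fib_root i (\<eta> ^ j) \<noteq> fib_root i (\<eta> ^ k)"
    using fib_root_diff[of "\<eta> ^ j" "\<eta> ^ k" i] \<eta>_nonzero by auto
qed auto

lemma fibpoly_fib_root_power:
  assumes "k \<in> {0<..<n}"
  shows "poly (ipoly (fibpoly m)) (fib_root i (\<eta> ^ k)) = 0 \<longleftrightarrow> n dvd k * m"
proof -
  have "\<not> 2 * n dvd k * 2" using assms by (auto dest!: dvd_imp_le)
  then have "(\<eta> ^ k) ^ 2 \<noteq> 1" using prim_rootsD[OF \<eta>] by (metis power_mult)
  then have "poly (ipoly (fibpoly m)) (fib_root i (\<eta> ^ k)) = 0 \<longleftrightarrow> (\<eta> ^ k) ^ (2 * m) = 1"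
    using i \<eta>_nonzero by (intro fibpoly_fib_root_eq_0_iff) auto
  also have "\<dots> \<longleftrightarrow> 2 * n dvd k * (2 * m)" using prim_rootsD[OF \<eta>] by (metis power_mult)
  also have "\<dots> \<longleftrightarrow> n dvd k * m" by (simp add: mult.left_commute)
  finally show ?thesis .
qed

text \<open>The values on the right are n - 1 distinct zeros of the monic F_n, whose degree is n -
  1.\<close>

lemma fibpoly_eq_prod:
  "ipoly (fibpoly n) = (\<Prod>r\<in>(\<lambda>k. fib_root i (\<eta> ^ k)) ` {0<..<n}. [:-r, 1:])"
proof (rule monic_eq_prod_linear)
  obtain m where m: "n = Suc m" using n by (cases n) auto
  show "lead_coeff (ipoly (fibpoly n) :: 'a poly) = 1"
    using fibpoly_monic[of m] unfolding lead_coeff_ipoly m by (metis of_int_1)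
  show "degree (ipoly (fibpoly n) :: 'a poly) = card ((\<lambda>k. fib_root i (\<eta> ^ k)) ` {0<..<n})"
    using inj_on_fib_root fibpoly_monic[of m] m by (simp add: degree_ipoly card_image)
qed (auto simp: fibpoly_fib_root_power)

lemma primitive_fib_roots:
  "{r::'a. poly (ipoly (fibpoly n)) r = 0 \<and> (\<forall>k. 1 \<le> k \<and> k < n \<longrightarrow> poly (ipoly (fibpoly k)) r \<noteq> 0)} =
    (\<lambda>k. fib_root i (\<eta> ^ k)) ` totatives n"
proof (intro Set.set_eqI iffI)
  fix r :: 'a assume "r \<in> {r. poly (ipoly (fibpoly n)) r = 0 \<and> (\<forall>k. 1 \<le> k \<and> k < n \<longrightarrow> poly (ipoly (fibpoly k)) r \<noteq> 0)}"
  then have r: "poly (ipoly (fibpoly n)) r = 0" "\<And>k. 1 \<le> k \<Longrightarrow> k < n \<Longrightarrow> poly (ipoly (fibpoly k)) r \<noteq> 0"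
    by auto
  from r(1) obtain k where k: "k \<in> {0<..<n}" "r = fib_root i (\<eta> ^ k)"
    unfolding fibpoly_eq_prod by (auto simp: poly_prod)
  have "coprime k n"
  proof (rule ccontr)
    define g where "g = gcd k n"
    assume "\<not> coprime k n"
    then have "g \<noteq> 1" unfolding g_def using coprime_iff_gcd_eq_1 by blast
    moreover have "g > 0" using n by (simp add: g_def)
    ultimately have "g > 1" by simp
    \<comment> \<open>The index m = n / gcd(k, n) is smaller than n and satisfies n | k m, so F_m
      already vanishes at this root.\<close>
    obtain m where m: "n = g * m" using gcd_dvd2[of k n] unfolding g_def by blast
    obtain l where l: "k = g * l" using gcd_dvd1[of k n] unfolding g_def by blast
    have "m > 0" using m n by (cases m) auto
    moreover from this have "m < n" using m \<open>g > 1\<close> by simp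
    ultimately
    have "\<not> n dvd k * m" using r(2)[of m] k by (simp add: fibpoly_fib_root_power)
    with m l show False by (simp add: mult_ac)
  qed
  then show "r \<in> (\<lambda>k. fib_root i (\<eta> ^ k)) ` totatives n" using k by (auto simp: in_totatives_iff)
next
  fix r assume "r \<in> (\<lambda>k. fib_root i (\<eta> ^ k)) ` totatives n"
  then obtain k where k: "k \<in> totatives n" "r = fib_root i (\<eta> ^ k)" by blast
  then have kn: "k \<in> {0<..<n}" using totatives_subset_interval[OF n] by blast
  have "coprime n k" using k(1) by (simp add: in_totatives_iff coprime_commute)
  then have "n dvd k * m \<longleftrightarrow> n dvd m" for m by (rule coprime_dvd_mult_right_iff)
  then show "r \<in> {r. poly (ipoly (fibpoly n)) r = 0 \<and> (\<forall>k. 1 \<le> k \<and> k < n \<longrightarrow> poly (ipoly (fibpoly k)) r \<noteq> 0)}"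
    using fibpoly_fib_root_power[OF kn] k(2) by (auto dest: dvd_imp_le)
qed

text \<open>For an irreducible q with root r, q | F_k is equivalent to F_k(r) = 0, so the condition
  on factors matches the one on roots in \<open>primitive_fib_roots\<close>. Squarefreeness is
  inherited from F_n, whose roots are distinct.\<close>

lemma fibotomic_eq_prod:
  "ipoly (fibotomic n) = (\<Prod>r\<in>(\<lambda>k. fib_root i (\<eta> ^ k)) ` totatives n. [:-r, 1:])"
proof -
  define S where "S = {q. lead_coeff q = 1 \<and> irreducible q \<and> q dvd fibpoly n \<and>
               (\<forall>k. 1 \<le> k \<and> k < n \<longrightarrow> \<not> q dvd fibpoly k)}"
  have fib: "fibotomic n = \<Prod>S" using n by (simp add: fibotomic_def S_def)
  obtain m where m: "n = Suc m" using n by (cases n) auto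
  have monic: "lead_coeff (fibpoly n) = 1" using fibpoly_monic[of m] unfolding m by blast
  then have nz: "fibpoly n \<noteq> 0" by auto
  \<comment> \<open>Monic polynomials are normalized, so \<open>S\<close> lies among the
    representatives in \<open>prime_factors\<close>; hence \<open>S\<close> is finite and its
    product divides F_n.\<close>
  have normal: "normalize q = q" if "lead_coeff q = 1" for q :: "int poly"
    using that by (simp add: normalize_poly_eq_map_poly)
  have sub: "S \<subseteq> prime_factors (fibpoly n)"
    using nz by (auto simp: S_def in_prime_factors_iff normal prime_def irreducible_imp_prime_elem)
  then have "finite S" by (rule finite_subset) simp
  have "mset_set S \<subseteq># prime_factorization (fibpoly n)"
    using sub by (metis finite_set_mset mset_set_set_mset_msubset msubset_mset_set_iff subset_mset.order_trans \<open>finite S\<close>)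
  then have "prod_mset (mset_set S) dvd prod_mset (prime_factorization (fibpoly n))"
    by (rule prod_mset_subset_imp_dvd)
  moreover have assoc: "normalize (prod_mset (prime_factorization (fibpoly n))) = normalize (fibpoly n)"
    using nz by (rule prod_mset_prime_factorization_weak)
  ultimately have "fibotomic n dvd fibpoly n"
    unfolding fib prod_unfold_prod_mset by (metis dvd_normalize_iff image_mset.identity id_apply)
  then have "ipoly (fibotomic n) dvd (ipoly (fibpoly n) :: 'a poly)" by (rule ipoly_dvd)
  moreover have "rsquarefree (ipoly (fibpoly n) :: 'a poly)"
    unfolding fibpoly_eq_prod by (intro rsquarefree_prod_linear) simp
  ultimately have "rsquarefree (ipoly (fibotomic n) :: 'a poly)" by (rule rsquarefree_dvd)
  moreover have "lead_coeff (ipoly (fibotomic n) :: 'a poly) = 1"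
  proof -
    have "lead_coeff (fibotomic n) = (\<Prod>q\<in>S. lead_coeff q)" unfolding fib by (rule lead_coeff_prod)
    also have "\<dots> = 1" by (rule prod.neutral) (simp add: S_def)
    finally show ?thesis unfolding lead_coeff_ipoly by simp
  qed
  moreover have "{r. poly (ipoly (fibotomic n)) r = 0} = (\<lambda>k. fib_root i (\<eta> ^ k)) ` totatives n"
    unfolding primitive_fib_roots[symmetric]
  proof (intro Set.set_eqI iffI)
    fix r :: 'a assume "r \<in> {r. poly (ipoly (fibotomic n)) r = 0}"
    then obtain q where q: "q \<in> S" "poly (ipoly q) r = 0"
      using \<open>finite S\<close> by (auto simp: fib ipoly_prod poly_prod)
    from q(1) have "ipoly q dvd (ipoly (fibpoly n) :: 'a poly)" by (auto simp: S_def intro: ipoly_dvd)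
    then have "poly (ipoly (fibpoly n)) r = 0" using q(2) by (auto elim!: dvdE)
    moreover have "poly (ipoly (fibpoly k)) r \<noteq> 0" if "1 \<le> k" "k < n" for k
      using irreducible_dvd_if_common_root[OF _ q(2)] q(1) that by (auto simp: S_def)
    ultimately show "r \<in> {r. poly (ipoly (fibpoly n)) r = 0 \<and> (\<forall>k. 1 \<le> k \<and> k < n \<longrightarrow> poly (ipoly (fibpoly k)) r \<noteq> 0)}"
      by blast
  next
    fix r :: 'a assume "r \<in> {r. poly (ipoly (fibpoly n)) r = 0 \<and> (\<forall>k. 1 \<le> k \<and> k < n \<longrightarrow> poly (ipoly (fibpoly k)) r \<noteq> 0)}"
    then have r: "poly (ipoly (fibpoly n)) r = 0" "\<And>k. 1 \<le> k \<Longrightarrow> k < n \<Longrightarrow> poly (ipoly (fibpoly k)) r \<noteq> 0"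
      by auto
    have "\<exists>q \<in># prime_factorization (fibpoly n). poly (ipoly q) r = 0"
    proof -
      have "ipoly (prod_mset A) = (\<Prod>q\<in>#A. ipoly q :: 'a poly)" for A
        by (induction A) (simp_all add: ipoly_mult)
      moreover have "fibpoly n dvd prod_mset (prime_factorization (fibpoly n))"
        by (metis assoc dvd_normalize_iff dvd_refl)
      ultimately have "ipoly (fibpoly n) dvd (\<Prod>q\<in>#prime_factorization (fibpoly n). ipoly q :: 'a poly)"
        using ipoly_dvd by metis
      with r(1) have "(\<Prod>q\<in>#prime_factorization (fibpoly n). poly (ipoly q) r) = 0"
        by (auto simp: poly_prod_mset simp flip: poly_prod_mset elim!: dvdE)
      then show ?thesis by auto
    qed
    then obtain q where q: "prime q" "q dvd fibpoly n" "poly (ipoly q) r = 0"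
      by (auto simp: in_prime_factors_iff)
    \<comment> \<open>The leading coefficient divides that of the monic F_n, so it is 1 or -1;
      \<open>prime\<close> includes normalization, which excludes -1.\<close>
    have "lead_coeff q = 1"
    proof -
      from q(2) obtain h where "fibpoly n = q * h" by (elim dvdE)
      then have "lead_coeff q * lead_coeff h = 1" using monic by (simp add: lead_coeff_mult)
      then have "lead_coeff q dvd 1" by (metis dvd_triv_left)
      moreover have "normalize q = q" using q(1) by (simp add: prime_def)
      then have "unit_factor q = 1" using q(1) by (metis normalize_idem_imp_unit_factor_eq not_prime_0 unit_factor_1 unit_factor_normalize)
      then have "sgn (lead_coeff q) = 1" by (simp add: unit_factor_poly_def one_pCons)
      ultimately show ?thesis by (auto simp: sgn_1_pos)
    qed
    moreover have "\<not> q dvd fibpoly k" if "1 \<le> k" "k < n" for k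
    proof
      assume "q dvd fibpoly k"
      then have "ipoly q dvd (ipoly (fibpoly k) :: 'a poly)" by (rule ipoly_dvd)
      then show False using q(3) r(2)[OF that] by (auto elim!: dvdE)
    qed
    ultimately have "q \<in> S" using q by (auto simp: S_def prime_def prime_elem_imp_irreducible)
    then show "r \<in> {r. poly (ipoly (fibotomic n)) r = 0}"
      using q(3) \<open>finite S\<close> by (auto simp: fib ipoly_prod poly_prod)
  qed
  ultimately show ?thesis using rsquarefree_eq_prod_roots[of "ipoly (fibotomic n) :: 'a poly"] by simp
qed

end

section \<open>Differences of the roots of the fibotomic polynomials\<close>

text \<open>The factor Phi_n(1) collects the factors 1 - 1/z_k by which each inner product is
  multiplied, so that nothing has to be divided.\<close>

lemma prod_fib_root_diffs:
  fixes i \<eta> :: "'a::{alg_closed_field,field_char_0}"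
  assumes i: "i ^ 2 = -1" and \<eta>: "\<eta> \<in> prim_roots (2 * n)" and n: "n > 2"
  shows "(\<Prod>k\<in>totatives n. \<Prod>l\<in>totatives n - {k}. fib_root i (\<eta> ^ k) - fib_root i (\<eta> ^ l)) * poly (cyc n) 1 =
    2 ^ totient n * cyc_diffs n"
proof -
  let ?T = "totatives n"
  define h where "h = (\<lambda>k. \<eta> ^ k)"
  define z where "z = (\<lambda>k. h k ^ 2)"
  have \<eta>2: "\<eta> ^ 2 \<in> prim_roots n" using power_mem_prim_roots[of \<eta> n 2] \<eta> by (simp add: mult.commute)
  have z: "z k = (\<eta> ^ 2) ^ k" for k by (simp add: z_def h_def mult.commute flip: power_mult)
  have nz: "\<eta> \<noteq> 0" using \<eta> n prim_roots_nonzero[of \<eta> "2 * n"] by simp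
  have hnz: "h k \<noteq> 0" for k using nz by (simp add: h_def)
  have bij: "bij_betw z ?T (prim_roots n)"
    unfolding z using bij_betw_totatives_prim_roots[OF \<eta>2] n by simp
  have \<eta>n: "\<eta> ^ n = -1"
  proof -
    have "\<not> 2 * n dvd n" using n by (auto dest: dvd_imp_le)
    then have "\<eta> ^ n \<noteq> 1" using prim_rootsD[OF \<eta>] by simp
    moreover have "(\<eta> ^ n) ^ 2 = 1" using prim_rootsD[OF \<eta>, of "n * 2"] by (simp add: power_mult mult.commute)
    ultimately show ?thesis by (simp add: power2_eq_1_iff)
  qed
  have refl: "h (n - k) = - inverse (h k)" if "k \<in> ?T" for k
  proof -
    have "h (n - k) * h k = -1" using that \<eta>n by (simp add: h_def in_totatives_iff flip: power_add)
    then show ?thesis using hnz[of k] by (simp add: field_simps)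
  qed
  note reindex = prod.reindex_bij_betw[OF bij_betw_totatives_diff[of n]]
  have inner: "(1 - inverse (z k)) * (\<Prod>l\<in>?T - {k}. fib_root i (h k) - fib_root i (h l)) =
    2 * (i * inverse (h k)) ^ (totient n - 1) * poly (pderiv (cyc n)) (z k)" if k: "k \<in> ?T" for k
  proof -
    let ?A = "\<Prod>l\<in>?T - {k}. h k - h l" and ?B = "\<Prod>l\<in>?T - {k}. h k - inverse (h l)"
      and ?C = "\<Prod>l\<in>?T - {k}. h k + h l"
    have "(\<Prod>l\<in>?T - {k}. fib_root i (h k) - fib_root i (h l)) =
      (\<Prod>l\<in>?T - {k}. i * inverse (h k) * (h k - h l) * (h k - inverse (h l)))"
      using hnz i by (intro prod.cong refl fib_root_diff) auto
    also have "\<dots> = (i * inverse (h k)) ^ (totient n - 1) * ?A * ?B"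
      using k by (simp add: prod.distrib totient_def)
    finally have 1: "(\<Prod>l\<in>?T - {k}. fib_root i (h k) - fib_root i (h l)) = \<dots>" .
    \<comment> \<open>The reflection permutes all totatives but not those other than k, so the
      factor at l = k is added first: h_k - 1/h_k before the reflection, 2 h_k after it.\<close>
    have "(h k - inverse (h k)) * ?B = (\<Prod>l\<in>?T. h k - inverse (h l))"
      using k by (simp add: prod.remove)
    also have "\<dots> = (\<Prod>l\<in>?T. h k + h (n - l))" by (rule prod.cong) (simp_all add: refl)
    also have "\<dots> = (\<Prod>l\<in>?T. h k + h l)" using n by (intro reindex) simp
    also have "\<dots> = 2 * h k * ?C" using k by (simp add: prod.remove)
    finally have "h k * ((1 - inverse (z k)) * ?B) = h k * (2 * ?C)"
      using hnz[of k] by (simp add: z_def field_simps power2_eq_square)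
    then have 2: "(1 - inverse (z k)) * ?B = 2 * ?C" using hnz[of k] by simp
    have "?A * ?C = (\<Prod>l\<in>?T - {k}. z k - z l)"
      unfolding prod.distrib[symmetric] by (intro prod.cong) (simp_all add: z_def power2_eq_square algebra_simps)
    also have "\<dots> = (\<Prod>w\<in>z ` (?T - {k}). z k - w)"
      using bij by (subst prod.reindex) (auto simp: bij_betw_def intro: inj_on_subset)
    also have "z ` (?T - {k}) = prim_roots n - {z k}"
      using bij k by (auto simp: bij_betw_def inj_on_def)
    also have "(\<Prod>w\<in>prim_roots n - {z k}. z k - w) = poly (pderiv (cyc n)) (z k)"
      using bij k n by (intro poly_pderiv_cyc [symmetric]) (auto simp: bij_betw_def)
    finally have 3: "?A * ?C = poly (pderiv (cyc n)) (z k)" .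
    have "(1 - inverse (z k)) * (\<Prod>l\<in>?T - {k}. fib_root i (h k) - fib_root i (h l)) =
      (i * inverse (h k)) ^ (totient n - 1) * ?A * ((1 - inverse (z k)) * ?B)"
      unfolding 1 by (simp only: mult_ac)
    also have "\<dots> = 2 * (i * inverse (h k)) ^ (totient n - 1) * (?A * ?C)"
      unfolding 2 by (simp only: mult_ac)
    finally show ?thesis unfolding 3 .
  qed
  have "poly (cyc n) 1 = (\<Prod>k\<in>?T. 1 - z k)"
    unfolding poly_cyc using prod.reindex_bij_betw[OF bij, of "\<lambda>z. 1 - z"] by simp
  also have "\<dots> = (\<Prod>k\<in>?T. 1 - z (n - k))"
    using n by (intro reindex[symmetric]) simp
  also have "\<dots> = (\<Prod>k\<in>?T. 1 - inverse (z k))"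
    by (rule prod.cong) (simp_all add: z_def refl power_inverse)
  finally have "(\<Prod>k\<in>?T. \<Prod>l\<in>?T - {k}. fib_root i (h k) - fib_root i (h l)) * poly (cyc n) 1 =
    (\<Prod>k\<in>?T. (1 - inverse (z k)) * (\<Prod>l\<in>?T - {k}. fib_root i (h k) - fib_root i (h l)))"
    by (simp add: prod.distrib mult.commute)
  also have "\<dots> = (\<Prod>k\<in>?T. 2 * (i * inverse (h k)) ^ (totient n - 1) * poly (pderiv (cyc n)) (z k))"
    by (intro prod.cong inner) auto
  also have "\<dots> = 2 ^ totient n * (\<Prod>k\<in>?T. i * inverse (h k)) ^ (totient n - 1) * (\<Prod>k\<in>?T. poly (pderiv (cyc n)) (z k))"
    by (simp only: prod.distrib prod_power_distrib[symmetric] prod_constant totient_def)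
  also have "(\<Prod>k\<in>?T. poly (pderiv (cyc n)) (z k)) = cyc_diffs n"
    unfolding cyc_diffs_def using bij by (rule prod.reindex_bij_betw)
  \<comment> \<open>With phi(n) = 2t the totatives sum to n t, so i^phi(n) and the product of the
    eta^k are both (-1)^t.\<close>
  also have "(\<Prod>k\<in>?T. i * inverse (h k)) = 1"
  proof -
    obtain t where t: "totient n = 2 * t" using totient_even[OF n] by auto
    then have s: "(\<Sum>k\<in>?T. k) = n * t" using sum_totatives[of n] n by simp
    have "(\<Prod>k\<in>?T. i * inverse (h k)) = i ^ totient n * inverse (\<Prod>k\<in>?T. h k)"
      by (simp add: prod.distrib totient_def flip: prod_inversef)
    also have "i ^ totient n = (-1) ^ t" by (simp add: t power_mult i)
    also have "(\<Prod>k\<in>?T. h k) = \<eta> ^ (n * t)" unfolding h_def s[symmetric] by (rule power_sum[symmetric])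
    also have "\<dots> = (-1) ^ t" by (simp add: power_mult \<eta>n)
    finally show ?thesis by simp
  qed
  finally show ?thesis by (simp add: h_def)
qed

lemma prod_fib_root_diffs_eq:
  fixes i \<eta> :: "'a::{alg_closed_field,field_char_0}"
  assumes i: "i ^ 2 = -1" and \<eta>: "\<eta> \<in> prim_roots (2 * n)" and n: "n \<ge> 2"
  shows "(\<Prod>k\<in>totatives n. \<Prod>l\<in>totatives n - {k}. fib_root i (\<eta> ^ k) - fib_root i (\<eta> ^ l)) =
    of_nat (2 * n) ^ totient n / (poly (cyc n) 1 * of_nat (disc_denom n))" (is "?P = _")
proof -
  have D: "cyc_diffs n * of_nat (disc_denom n) = (of_nat n ^ totient n :: 'a)"
    using n by (intro cyc_diffs_eq) simp
  have "?P * poly (cyc n) 1 = 2 ^ totient n * cyc_diffs n"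
  proof (cases "n = 2")
    \<comment> \<open>There is a single root and the inner product is empty, so both sides equal
      2.\<close>
    case True
    have "{0<..<2::nat} = {1}" by auto
    then have "totatives 2 = {1}" by (simp only: totatives_prime[OF two_is_prime_nat])
    moreover have "poly (cyc 2) (1::'a) = 2"
      using poly_cyc_1_prime_power[OF two_is_prime_nat, of 0, where 'a = 'a]
      by (simp only: power_Suc0_right of_nat_numeral)
    moreover have "prime_factors (2::nat) = {2}" by (simp add: prime_prime_factors)
    then have "cyc_diffs 2 = (1::'a)" using D True by (simp add: disc_denom_def)
    ultimately show ?thesis using True by simp
  next
    case False
    then show ?thesis using prod_fib_root_diffs[OF i \<eta>] n by simp
  qed
  then have "?P * (poly (cyc n) 1 * of_nat (disc_denom n)) = 2 ^ totient n * (cyc_diffs n * of_nat (disc_denom n))"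
    by (simp only: mult.assoc[symmetric])
  also have "\<dots> = of_nat (2 * n) ^ totient n" unfolding D by (simp add: power_mult_distrib)
  finally have "?P * (poly (cyc n) 1 * of_nat (disc_denom n)) = of_nat (2 * n) ^ totient n" .
  moreover have "poly (cyc n) (1::'a) \<noteq> 0"
    using n by (simp add: poly_cyc_eq_0_iff one_notin_prim_roots)
  moreover have "of_nat (disc_denom n) \<noteq> (0::'a)"
    using D n by (metis mult_zero_right not_numeral_le_zero of_nat_eq_0_iff power_not_zero)
  ultimately show ?thesis by (simp add: eq_divide_eq)
qed

section \<open>Discriminants of polynomials with distinct roots\<close>

lemma card_less_pairs: "card {(i, j). i < j \<and> j < (N::nat)} = N * (N - 1) div 2"
proof -
  have "{(i, j). i < j \<and> j < N} = prod.swap ` (SIGMA j:{..<N}. {..<j})" by force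
  then have "card {(i, j). i < j \<and> j < N} = card (SIGMA j:{..<N}. {..<j})"
    by (simp add: card_image)
  also have "\<dots> = (\<Sum>j<N. j)" by simp
  also have "\<dots> = N * (N - 1) div 2"
    by (simp add: Sum_Ico_nat lessThan_atLeast0)
  finally show ?thesis .
qed

text \<open>On the right each pair occurs in both orders and contributes (a - b)(b - a) = -(a -
  b)^2; the sign counts the pairs.\<close>

lemma prod_square_diffs_distinct:
  fixes xs :: "'a::comm_ring_1 list"
  assumes "distinct xs"
  shows "(\<Prod>(i, j)\<in>{(i, j). i < j \<and> j < length xs}. (xs ! i - xs ! j) ^ 2) =
    (-1) ^ (length xs * (length xs - 1) div 2) * (\<Prod>x\<in>set xs. \<Prod>y\<in>set xs - {x}. x - y)"
proof -
  let ?N = "length xs"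
  let ?U = "{(i, j). i < j \<and> j < ?N}"
  have fin: "finite ?U" by (rule finite_subset[of _ "{..<?N} \<times> {..<?N}"]) auto
  have bij: "bij_betw ((!) xs) {..<?N} (set xs)" using assms by (rule bij_betw_nth) auto
  have "(\<Prod>x\<in>set xs. \<Prod>y\<in>set xs - {x}. x - y) = (\<Prod>i<?N. \<Prod>y\<in>set xs - {xs ! i}. xs ! i - y)"
    by (rule prod.reindex_bij_betw[OF bij, symmetric])
  also have "\<dots> = (\<Prod>i<?N. \<Prod>j\<in>{..<?N} - {i}. xs ! i - xs ! j)"
  proof (rule prod.cong)
    fix i assume "i \<in> {..<?N}"
    then have "bij_betw ((!) xs) ({..<?N} - {i}) (set xs - {xs ! i})"
      using bij by (intro bij_betw_DiffI) auto
    then show "(\<Prod>y\<in>set xs - {xs ! i}. xs ! i - y) = (\<Prod>j\<in>{..<?N} - {i}. xs ! i - xs ! j)"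
      by (rule prod.reindex_bij_betw[symmetric])
  qed simp
  also have "\<dots> = (\<Prod>(i, j)\<in>(SIGMA i:{..<?N}. {..<?N} - {i}). xs ! i - xs ! j)"
    by (rule prod.Sigma) auto
  also have "(SIGMA i:{..<?N}. {..<?N} - {i}) = ?U \<union> prod.swap ` ?U" by (force simp: image_iff)
  also have "(\<Prod>(i, j)\<in>\<dots>. xs ! i - xs ! j) =
      (\<Prod>(i, j)\<in>?U. xs ! i - xs ! j) * (\<Prod>(i, j)\<in>prod.swap ` ?U. xs ! i - xs ! j)"
    using fin by (intro prod.union_disjoint) auto
  also have "(\<Prod>(i, j)\<in>prod.swap ` ?U. xs ! i - xs ! j) = (\<Prod>(i, j)\<in>?U. xs ! j - xs ! i)"
    by (subst prod.reindex) (auto simp: case_prod_unfold)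
  also have "(\<Prod>(i, j)\<in>?U. xs ! i - xs ! j) * \<dots> = (\<Prod>(i, j)\<in>?U. -1 * (xs ! i - xs ! j) ^ 2)"
    unfolding prod.distrib[symmetric] by (intro prod.cong) (auto simp: power2_eq_square algebra_simps)
  also have "\<dots> = (-1) ^ card ?U * (\<Prod>(i, j)\<in>?U. (xs ! i - xs ! j) ^ 2)"
    unfolding case_prod_unfold prod.distrib by simp
  finally have "(\<Prod>x\<in>set xs. \<Prod>y\<in>set xs - {x}. x - y) = \<dots>" .
  then show ?thesis unfolding card_less_pairs
    by (simp add: mult.assoc[symmetric] flip: power_mult_distrib)
qed

lemma degree_prod_list_linear: "degree (\<Prod>r\<leftarrow>xs. [:-r, 1::'a::idom:]) = length xs"
proof (induction xs)
  case (Cons x xs)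
  have "(\<Prod>r\<leftarrow>xs. [:-r, 1::'a:]) \<noteq> 0" by (induction xs) (auto simp del: mult_pCons_left)
  then have "degree ([:-x, 1:] * (\<Prod>r\<leftarrow>xs. [:-r, 1::'a:])) = Suc (length xs)"
    by (subst degree_mult_eq) (simp_all add: Cons)
  then show ?case by (simp del: mult_pCons_left)
qed simp

text \<open>The list behind \<open>discriminant\<close> is an arbitrary choice, but every list with
  this product has entry set A and length |A|, so it enumerates A without repetition.\<close>

lemma discriminant_eq:
  fixes f :: "'k::field poly"
  assumes "finite A" and f: "map_poly to_ac f = (\<Prod>r\<in>A. [:-r, 1:])"
  shows "discriminant f = (-1) ^ (card A * (card A - 1) div 2) * (\<Prod>x\<in>A. \<Prod>y\<in>A - {x}. x - y)"
proof -
  define xs where "xs = roots_list_ac f"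
  obtain ys where "distinct ys" "set ys = A" using finite_distinct_list[OF assms(1)] by blast
  then have "map_poly to_ac f = (\<Prod>r\<leftarrow>ys. [:-r, 1:])"
    using f prod.distinct_set_conv_list[of ys "\<lambda>r. [:-r, 1:]"] by simp
  then have xs: "map_poly to_ac f = (\<Prod>r\<leftarrow>xs. [:-r, 1:])"
    unfolding xs_def roots_list_ac_def by (rule someI)
  have "length xs = degree (\<Prod>r\<leftarrow>xs. [:-r, 1:])"
    using degree_prod_list_linear[of xs] by simp
  also have "\<dots> = card A" using xs f by (metis degree_prod_linear)
  finally have len: "length xs = card A" .
  have "poly (\<Prod>r\<leftarrow>xs. [:-r, 1:]) x = 0 \<longleftrightarrow> x \<in> set xs" for x
    by (induction xs) (auto simp del: mult_pCons_left)
  then have "set xs = {r. poly (\<Prod>r\<leftarrow>xs. [:-r, 1:]) r = 0}" by blast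
  also have "\<dots> = {r. poly (\<Prod>r\<in>A. [:-r, 1:]) r = 0}" using xs f by simp
  also have "\<dots> = A" using assms(1) by (auto simp: poly_prod)
  finally have set: "set xs = A" .
  have "distinct xs" using len set by (simp add: card_distinct)
  from prod_square_diffs_distinct[OF this] show ?thesis
    unfolding discriminant_def Let_def xs_def[symmetric] len set .
qed

text \<open>Up to sign the coefficient is the elementary symmetric polynomial of degree |T| - j in
  the roots, which is homogeneous. The proof uses x - c a = c (x/c - a).\<close>

lemma coeff_prod_linear_scale:
  fixes a :: "'b \<Rightarrow> 'a::field"
  assumes "c \<noteq> 0" "finite T" "j \<le> card T"
  shows "coeff (\<Prod>k\<in>T. [:-(c * a k), 1:]) j = c ^ (card T - j) * coeff (\<Prod>k\<in>T. [:-a k, 1:]) j"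
proof -
  have "(\<Prod>k\<in>T. [:-(c * a k), 1:]) = (\<Prod>k\<in>T. smult c (pcompose [:-a k, 1:] [:0, 1 / c:]))"
    using assms(1) by (simp add: pcompose_pCons)
  also have "\<dots> = smult (c ^ card T) (pcompose (\<Prod>k\<in>T. [:-a k, 1:]) [:0, 1 / c:])"
    by (simp add: prod_smult pcompose_prod)
  finally show ?thesis using assms
    by (simp add: coeff_pcompose_linear power_diff power_divide)
qed

section \<open>The homogenized fibotomic polynomials\<close>

lemma emb_mult: "emb (a * b) = emb a * emb b"
  by (simp add: emb_def flip: to_fract_def)

lemma emb_power: "emb (a ^ k) = emb a ^ k"
  by (induction k) (simp_all add: emb_mult, simp add: emb_def flip: to_fract_def)

lemma emb_const: "emb [:c:] = of_int c"
proof -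
  have nat: "to_fract (of_nat m :: int poly) = of_nat m" for m
    by (simp add: to_fract_def of_nat_fract)
  have "to_fract (of_int c :: int poly) = of_int c"
    by (cases c rule: int_cases2) (simp_all add: nat)
  then show ?thesis by (simp add: emb_def of_int_poly flip: to_fract_def)
qed

lemma emb_monom: "emb (monom c k) = of_int c * emb [:0, 1:] ^ k"
  by (simp add: monom_altdef emb_mult[symmetric] emb_power[symmetric] emb_const[symmetric])

lemma emb_X_nonzero: "emb [:0, 1:] \<noteq> 0"
  by (simp add: emb_def flip: to_fract_def)

lemma coeff_fibotomic_hom:
  assumes "n \<ge> 2"
  shows "coeff (fibotomic_hom n) j =
    (if j \<le> totient n then monom (coeff (fibotomic n) j) (totient n - j) else 0)"
  using assms by (simp add: fibotomic_hom_def coeff_sum)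

text \<open>The power y^(phi(n)-j) attached to x^j is exactly the factor of
  \<open>coeff_prod_linear_scale\<close> with c = y.\<close>

lemma fibotomic_hom_eq_prod:
  fixes i \<eta> :: "int poly fract alg_closure"
  assumes i: "i ^ 2 = -1" and \<eta>: "\<eta> \<in> prim_roots (2 * n)" and n: "n \<ge> 2"
  shows "map_poly to_ac (map_poly (\<lambda>c. Fraction_Field.Fract c 1) (fibotomic_hom n)) =
    (\<Prod>k\<in>totatives n. [:-(emb [:0, 1:] * fib_root i (\<eta> ^ k)), 1:])" (is "?L = ?R")
proof (rule poly_eqI)
  fix j
  have inj: "inj_on (\<lambda>k. fib_root i (\<eta> ^ k)) (totatives n)"
    using inj_on_fib_root[OF i \<eta> n] totatives_subset_interval[OF n] by (rule inj_on_subset)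
  have psi: "ipoly (fibotomic n) = (\<Prod>k\<in>totatives n. [:-fib_root i (\<eta> ^ k), 1:])"
    unfolding fibotomic_eq_prod[OF i \<eta> n] using inj by (subst prod.reindex) simp_all
  have deg: "degree ?R = totient n"
    by (subst degree_prod_eq_sum_degree) (simp_all add: totient_def)
  have "coeff ?L j = emb (coeff (fibotomic_hom n) j)"
    by (simp add: coeff_map_poly emb_def flip: to_fract_def)
  also have "\<dots> = coeff ?R j"
  proof (cases "j \<le> totient n")
    case True
    have "emb (coeff (fibotomic_hom n) j) = emb [:0, 1:] ^ (totient n - j) * coeff (ipoly (fibotomic n)) j"
      using True n by (simp add: coeff_fibotomic_hom emb_monom coeff_map_poly mult.commute)
    also have "\<dots> = coeff ?R j"
      unfolding psi using True coeff_prod_linear_scale[OF emb_X_nonzero, of "totatives n" j] by (simp add: totient_def)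
    finally show ?thesis .
  next
    case False
    then have "coeff ?R j = 0" using deg by (intro coeff_eq_0) simp
    moreover have "emb 0 = 0" by (simp add: emb_def flip: to_fract_def)
    ultimately show ?thesis using False n by (simp add: coeff_fibotomic_hom)
  qed
  finally show "coeff ?L j = coeff ?R j" .
qed

text \<open>For phi(n) = 2t the number of pairs is t(2t-1), which has the parity of t; for n = 2
  both exponents are 0.\<close>

lemma minus_one_power_totient:
  assumes "n \<ge> 2"
  shows "(-1) ^ (totient n * (totient n - 1) div 2) = ((-1) ^ (totient n div 2) :: 'a::ring_1)"
proof (cases "n = 2")
  case False
  then obtain t where t: "totient n = 2 * t" using totient_even[of n] assms by auto
  have "(-1) ^ (totient n * (totient n - 1) div 2) = ((-1) ^ (t * (2 * t - 1)) :: 'a)" by (simp add: t)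
  also have "\<dots> = (-1) ^ t"
    using assms t by (cases t) (simp_all add: minus_one_power_iff)
  finally show ?thesis by (simp add: t)
qed simp

text \<open>Both cases of the theorem at once, with Phi_n(1) still unevaluated. Each of the
  phi(n)(phi(n)-1) ordered pairs of roots contributes one factor y.\<close>

lemma discriminant_fibotomic_hom:
  assumes n: "n \<ge> 2"
  shows "discriminant (map_poly (\<lambda>c. Fraction_Field.Fract c 1) (fibotomic_hom n)) =
    emb ([:(-1) ^ (totient n div 2) * (2 * int n) ^ totient n:] * [:0, 1:] ^ (totient n * (totient n - 1))) /
    (poly (cyc n) 1 * of_nat (disc_denom n))"
proof -
  let ?Y = "emb [:0, 1:]" and ?T = "totatives n"
  obtain i :: "int poly fract alg_closure" where i: "i ^ 2 = -1"
    using nth_root_exists[of 2 "-1 :: int poly fract alg_closure"] by auto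
  obtain \<eta> :: "int poly fract alg_closure" where \<eta>: "\<eta> \<in> prim_roots (2 * n)"
    using prim_root_exists[of "2 * n"] n by auto
  define r where "r = (\<lambda>k. ?Y * fib_root i (\<eta> ^ k))"
  have "inj_on (\<lambda>k. fib_root i (\<eta> ^ k)) ?T"
    using inj_on_fib_root[OF i \<eta> n] totatives_subset_interval[OF n] by (rule inj_on_subset)
  then have inj: "inj_on r ?T" using emb_X_nonzero by (simp add: r_def inj_on_def)
  have card: "card (r ` ?T) = totient n" using inj by (simp add: card_image totient_def)
  have "(\<Prod>x\<in>r ` ?T. \<Prod>y\<in>r ` ?T - {x}. x - y) = (\<Prod>k\<in>?T. \<Prod>y\<in>r ` ?T - {r k}. r k - y)"
    using inj by (simp add: prod.reindex)
  also have "\<dots> = (\<Prod>k\<in>?T. \<Prod>l\<in>?T - {k}. r k - r l)"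
  proof (rule prod.cong)
    fix k assume "k \<in> ?T"
    then have "r ` ?T - {r k} = r ` (?T - {k})" using inj by (auto simp: inj_on_def)
    then show "(\<Prod>y\<in>r ` ?T - {r k}. r k - y) = (\<Prod>l\<in>?T - {k}. r k - r l)"
      using inj by (simp add: prod.reindex inj_on_diff)
  qed simp
  also have "\<dots> = (\<Prod>k\<in>?T. \<Prod>l\<in>?T - {k}. ?Y * (fib_root i (\<eta> ^ k) - fib_root i (\<eta> ^ l)))"
    by (simp add: r_def right_diff_distrib)
  also have "\<dots> = (\<Prod>k\<in>?T. ?Y ^ (totient n - 1) * (\<Prod>l\<in>?T - {k}. fib_root i (\<eta> ^ k) - fib_root i (\<eta> ^ l)))"
    by (intro prod.cong) (simp_all add: prod.distrib totient_def)
  also have "\<dots> = ?Y ^ (totient n * (totient n - 1)) *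
      (\<Prod>k\<in>?T. \<Prod>l\<in>?T - {k}. fib_root i (\<eta> ^ k) - fib_root i (\<eta> ^ l))"
    unfolding prod.distrib by (simp add: totient_def mult.commute flip: power_mult)
  finally have P: "(\<Prod>x\<in>r ` ?T. \<Prod>y\<in>r ` ?T - {x}. x - y) = ?Y ^ (totient n * (totient n - 1)) *
      (of_nat (2 * n) ^ totient n / (poly (cyc n) 1 * of_nat (disc_denom n)))"
    unfolding prod_fib_root_diffs_eq[OF i \<eta> n] .
  have "map_poly to_ac (map_poly (\<lambda>c. Fraction_Field.Fract c 1) (fibotomic_hom n)) = (\<Prod>x\<in>r ` ?T. [:-x, 1:])"
    unfolding fibotomic_hom_eq_prod[OF i \<eta> n] using inj by (subst prod.reindex) (simp_all add: r_def)
  from discriminant_eq[OF _ this]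
  have "discriminant (map_poly (\<lambda>c. Fraction_Field.Fract c 1) (fibotomic_hom n)) =
    (-1) ^ (totient n div 2) * (\<Prod>x\<in>r ` ?T. \<Prod>y\<in>r ` ?T - {x}. x - y)"
    by (simp add: card minus_one_power_totient[OF n, simplified])
  then show ?thesis unfolding P emb_mult emb_power emb_const by simp
qed

theorem theorem1:
  fixes n :: nat
  assumes "n \<ge> 2"
  shows "(\<forall>p \<alpha>. prime (p::nat) \<and> (\<alpha>::nat) \<ge> 1 \<and> n = p ^ \<alpha> \<longrightarrow>
           discriminant (map_poly (\<lambda>c. Fraction_Field.Fract c 1) (fibotomic_hom n)) =
           emb ([:(-1) ^ (totient n div 2) * (2 * int n) ^ totient n:]
                * [:0, 1:] ^ (totient n * (totient n - 1)))
           / emb [:int p ^ (p ^ (\<alpha> - 1) + 1):])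
       \<and> ((\<nexists>p \<alpha>. prime (p::nat) \<and> (\<alpha>::nat) \<ge> 1 \<and> n = p ^ \<alpha>) \<longrightarrow>
           discriminant (map_poly (\<lambda>c. Fraction_Field.Fract c 1) (fibotomic_hom n)) =
           emb ([:(-1) ^ (totient n div 2) * (2 * int n) ^ totient n:]
                * [:0, 1:] ^ (totient n * (totient n - 1)))
           / emb [:\<Prod>p\<in>prime_factors n. int p ^ (totient n div (p - 1)):])"
proof (intro conjI allI impI, goal_cases)
  case (1 p \<alpha>)
  then obtain k where k: "\<alpha> = Suc k" "prime p" "n = p ^ Suc k" by (cases \<alpha>) auto
  have "poly (cyc n) 1 = (of_nat p :: int poly fract alg_closure)"
    unfolding k using k(2) by (rule poly_cyc_1_prime_power)
  \<comment> \<open>The exponent is phi(p^(k+1)) / (p-1) = p^k; the remaining factor p of the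
    denominator is Phi_n(1).\<close>
  moreover have "disc_denom n = p ^ p ^ k"
  proof -
    have "prime_factors n = {p}" using k by (simp add: prime_factors_power prime_prime_factors del: power_Suc)
    moreover have "totient n = p ^ k * (p - 1)" using k by (simp add: totient_prime_power_Suc del: power_Suc)
    ultimately show ?thesis using prime_gt_1_nat[OF k(2)] by (simp add: disc_denom_def)
  qed
  ultimately show ?case
    unfolding discriminant_fibotomic_hom[OF assms] by (simp add: emb_const k(1))
next
  case 2
  then have "\<nexists>p k. prime p \<and> n = p ^ Suc k" by (metis One_nat_def Suc_le_mono le0)
  then have "poly (cyc n) 1 = (1 :: int poly fract alg_closure)"
    using assms by (intro poly_cyc_1_not_prime_power) simp_all
  then show ?case
    unfolding discriminant_fibotomic_hom[OF assms] by (simp add: emb_const disc_denom_def)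
qed

end
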